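(* Let $m,n$ be positive integers with $n\ge m$, and let $$\Theta_2=\sum_{k=1}^\infty (-1)^k\frac{\psi\left(\frac{2k+2n+5}{4}\right)-\psi\left(\frac{2k+2n+3}{4}\right)}{(2k+2m)^2}.$$ Then: (i) if $n=m$: $$\Theta_2=(-1)^m\left(-4-\sum_{k=1}^m\sum_{j=0}^k\frac{(-1)^j}{k^2(2j+1)}+\left(1+\sum_{k=1}^m\frac{1}{4k^2}\right)\pi+2\ln 2-\frac{\pi}{4}\ln^2 2-\frac{\pi^2}{12}-\frac{5\pi^3}{48}-2G\ln 2+4\,\Im(\mathrm{Li}_3(1+i))\right);$$ (ii) if $n=m+1$: $$\Theta_2=(-1)^m\left(\frac{116}{27}+\sum_{k=1}^m\sum_{j=0}^{k+1}\frac{(-1)^j}{k^2(2j+1)}-\left(\frac{10}{9}+\sum_{k=1}^m\frac{1}{4k^2}\right)\pi-\frac{16\ln 2}{9}+\frac{\pi}{4}\ln^2 2+\frac{\pi^2}{18}+\frac{5\pi^3}{48}+2G\ln 2-4\,\Im(\mathrm{Li}_3(1+i))\right);$$ (iii) if $n-m$ is odd and $n-m\neq1$: $$\begin{aligned}\Theta_2=(-1)^m\Bigg(&\frac{116}{27}-4\sum_{j=1}^{\frac{n-m-1}{2}}\frac{1}{(4j+3)^3}-\sum_{k=1}^m\sum_{j=0}^{k+n-m}\frac{(-1)^{j+n-m}}{k^2(2j+1)}+8\sum_{k=1}^{\frac{n-m-1}{2}}\sum_{j=0}^{2k}\frac{(-1)^j(16k^2+16k+5)}{(2j+1)(4k+3)^2(4k+1)^2}\\&+\left(-\frac{10}{9}-\sum_{j=1}^{\frac{n-m-1}{2}}\frac{2(16j^2+16j+5)}{(4j+3)^2(4j+1)^2}+\frac14\ln^2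 2+\sum_{k=1}^m\frac{(-1)^{n-m}}{4k^2}\right)\pi\\&-\left(\frac19+\sum_{j=1}^{\frac{n-m-1}{2}}\frac{2j+1}{(4j+3)^2(4j+1)^2}\right)16\ln 2+\left(\frac1{18}+\frac16\sum_{j=1}^{\frac{n-m-1}{2}}\frac{1}{(4j+3)(4j+1)}\right)\pi^2\\&+\frac{5\pi^3}{48}+2G\ln 2-4\,\Im(\mathrm{Li}_3(1+i))\Bigg);\end{aligned}$$ (iv) if $n-m$ is even: $$\begin{aligned}\Theta_2=(-1)^m\Bigg(&-4-4\sum_{j=0}^{\frac{n-m-2}{2}}\frac{1}{(4j+5)^3}-\sum_{k=1}^m\sum_{j=0}^{k+n-m}\frac{(-1)^{j+n-m}}{k^2(2j+1)}-8\sum_{k=0}^{\frac{n-m-2}{2}}\sum_{j=0}^{2k+1}\frac{(-1)^j(16k^2+32k+17)}{(2j+1)(4k+5)^2(4k+3)^2}\\&+\left(1+\sum_{j=0}^{\frac{n-m-2}{2}}\frac{2(16j^2+32j+17)}{(4j+5)^2(4j+3)^2}-\frac14\ln^2 2+\sum_{k=1}^m\frac{(-1)^{n-m}}{4k^2}\right)\pi\\&+\left(1-16\sum_{j=0}^{\frac{n-m-2}{2}}\frac{j+1}{(4j+5)^2(4j+3)^2}\right)2\ln 2+\left(-\frac12+\sum_{j=0}^{\frac{n-m-2}{2}}\frac{1}{(4j+5)(4j+3)}\right)\frac{\pi^2}{6}\\&-\frac{5\pi^3}{48}-2G\ln 2+4\,\Im(\mathrm{Li}_3(1+i))\Bigg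).\end{aligned}$$
   Context: $\psi=\Gamma'/\Gamma$ is the digamma function, $G=\sum_{k=0}^\infty\frac{(-1)^k}{(2k+1)^2}$ is Catalan's constant, and $\mathrm{Li}_3$ is the trilogarithm, $\mathrm{Li}_3(z)=\sum_{k\ge1}z^k/k^3$ for $|z|\le1$, analytically continued to $\mathbb C\setminus[1,\infty)$ (principal branch); $\Im(\mathrm{Li}_3(1+i))\approx1.2670834419$. Empty sums (such as $\sum_{j=0}^{-1}$) are $0$. *)

theory Defs
  imports "HOL-Complex_Analysis.Complex_Analysis"
begin

definition Catalan_G :: real where
  "Catalan_G = (\<Sum>k. (-1) ^ k / (2 * real k + 1) ^ 2)"

definition Li3_series :: "complex \<Rightarrow> complex" where
  "Li3_series z = (\<Sum>k. z ^ Suc k / of_nat (Suc k) ^ 3)"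

definition Li3_slit_plane :: "complex set" where
  "Li3_slit_plane = - (complex_of_real ` {1..})"

text \<open>
  Outside the closed unit disc, the value at \<open>z\<close> is the common value at \<open>z\<close> of all holomorphic
  functions on the slit plane that extend the series; by the lemma \<open>Li3_continuation_ex1\<close> below
  it is well defined for every \<open>z\<close> in the slit plane. For real \<open>z > 1\<close> the value is unspecified.
\<close>
definition Li3 :: "complex \<Rightarrow> complex" where
  "Li3 z = (if norm z \<le> 1 then Li3_series z
            else (THE w. \<exists>f. f holomorphic_on Li3_slit_plane \<and>
                             (\<forall>u\<in>ball 0 1. f u = Li3_series u) \<and> w = f z))"

definition Theta2_term :: "nat \<Rightarrow> nat \<Rightarrow> nat \<Rightarrow> real" where
  "Theta2_term m n k =
     (-1) ^ k * (Digamma ((2 * real k + 2 * real n + 5) / 4)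
                 - Digamma ((2 * real k + 2 * real n + 3) / 4))
       / (2 * real k + 2 * real m) ^ 2"

lemma open_Li3_slit_plane: "open Li3_slit_plane"
  unfolding Li3_slit_plane_def
  by (intro open_Compl closed_injective_linear_image) (auto intro: inj_of_real bounded_linear.linear bounded_linear_of_real)

lemma closed_segment_Li3_slit_plane:
  assumes "z \<in> Li3_slit_plane"
  shows "closed_segment 0 z \<subseteq> Li3_slit_plane"
proof
  fix w assume "w \<in> closed_segment 0 z"
  then obtain t where t: "0 \<le> t" "t \<le> 1" "w = of_real t * z"
    by (auto simp: closed_segment_def scaleR_conv_of_real)
  show "w \<in> Li3_slit_plane"
  proof (rule ccontr)
    assume "w \<notin> Li3_slit_plane"
    then obtain x where x: "w = of_real x" "1 \<le> x"
      by (auto simp: Li3_slit_plane_def)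
    with t have "t > 0" by (cases "t = 0") auto
    with x t have "z = of_real (x / t)" by (simp add: field_simps)
    moreover have "x / t \<in> {1..}" using x t \<open>t > 0\<close> by (simp add: field_simps)
    ultimately show False using assms unfolding Li3_slit_plane_def by blast
  qed
qed

lemma zero_in_Li3_slit_plane: "0 \<in> Li3_slit_plane"
  by (auto simp: Li3_slit_plane_def)

lemma ball_subset_Li3_slit_plane: "ball 0 1 \<subseteq> Li3_slit_plane"
  by (auto simp: Li3_slit_plane_def)

lemma starlike_Li3_slit_plane: "starlike Li3_slit_plane"
  unfolding starlike_def
  using zero_in_Li3_slit_plane closed_segment_Li3_slit_plane by blast

lemma polylog_continuation_step:
  assumes f: "f holomorphic_on Li3_slit_plane"
    and a: "\<And>z. z \<in> ball 0 1 \<Longrightarrow> (\<lambda>k. a k * z ^ k) sums f z"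
  shows "\<exists>F. F holomorphic_on Li3_slit_plane \<and>
             (\<forall>z\<in>ball 0 1. (\<lambda>k. a k / of_nat k * z ^ k) sums F z)"
proof -
  define S where "S = Li3_slit_plane"
  define c where "c = (\<lambda>k. a k / of_nat k :: complex)"
  define P where "P = (\<lambda>z. \<Sum>k. c k * z ^ k)"
  define g where "g = (\<lambda>z. if z = 0 then deriv f 0 else (f z - f 0) / (z - 0))"
  have g: "g holomorphic_on S"
    unfolding g_def S_def
    by (rule pole_lemma_open[OF f open_Li3_slit_plane])
  have "\<exists>F0. \<forall>z\<in>S. (F0 has_field_derivative g z) (at z)"
  proof (rule holomorphic_starlike_primitive)
    show "continuous_on S g" by (rule holomorphic_on_imp_continuous_on[OF g])
    show "g field_differentiable at z" if "z \<in> S - {}" for z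
      using that holomorphic_on_imp_differentiable_at[OF g] open_Li3_slit_plane
      by (simp add: S_def)
  qed (simp_all add: S_def open_Li3_slit_plane starlike_Li3_slit_plane)
  then obtain F0 where F0: "\<And>z. z \<in> S \<Longrightarrow> (F0 has_field_derivative g z) (at z)"
    by blast
  define F where "F = (\<lambda>z. F0 z - F0 0)"
  have F: "(F has_field_derivative g z) (at z)" if "z \<in> S" for z
    unfolding F_def using F0[OF that] by (auto intro!: derivative_eq_intros)
  have c_summable: "summable (\<lambda>k. c k * z ^ k)" if z: "norm z < 1" for z
  proof (rule summable_comparison_test')
    obtain r where r: "norm z < r" "r < 1" using dense[OF z] by blast
    then have "r > 0" using norm_ge_zero[of z] by linarith
    have "summable (\<lambda>k. a k * (of_real r) ^ k)"
      by (rule sums_summable, rule a) (use r \<open>r > 0\<close> in simp)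
    then show "summable (\<lambda>k. norm (a k * z ^ k))"
      by (rule powser_insidea) (use r \<open>r > 0\<close> in simp)
    show "norm (c k * z ^ k) \<le> norm (a k * z ^ k)" for k
    proof (cases "k = 0")
      case False
      then have "norm (a k) / real k \<le> norm (a k) / 1"
        by (intro divide_left_mono) auto
      then have "norm (a k) / real k * norm (z ^ k) \<le> norm (a k) * norm (z ^ k)"
        by (intro mult_right_mono) auto
      then show ?thesis by (simp add: c_def norm_mult norm_divide)
    qed (simp add: c_def)
  qed
  have diffs: "diffs c k = a (Suc k)" for k
    by (simp add: diffs_def c_def del: of_nat_Suc)
  have g_sums: "(\<Sum>k. a (Suc k) * z ^ k) = g z" if z: "z \<in> ball 0 1" "z \<noteq> 0" for z
  proof -
    have "(\<lambda>k. a (Suc k) * z ^ Suc k) sums (f z - a 0)"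
      using a[OF z(1)] sums_Suc_iff[of "\<lambda>k. a k * z ^ k"] by simp
    then have "(\<lambda>k. a (Suc k) * z ^ Suc k / z) sums ((f z - a 0) / z)"
      by (rule sums_divide)
    moreover have "a 0 = f 0"
    proof -
      have "(\<lambda>k. a k * 0 ^ k) sums f 0" using a[of 0] by simp
      then show ?thesis using powser_sums_zero_iff[of a] by simp
    qed
    ultimately show ?thesis using z by (simp add: g_def sums_iff)
  qed
  have P: "(P has_field_derivative (\<Sum>k. a (Suc k) * z ^ k)) (at z)" if "z \<in> ball 0 1" for z
    unfolding P_def using termdiffs_strong'[of 1 c z] c_summable that by (simp add: diffs)
  have "F z - P z = F 0 - P 0" if z: "z \<in> ball 0 1" for z
  proof -
    have "(\<lambda>z. F z - P z) constant_on ball 0 1"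
    proof (rule DERIV_zero_connected_constant_on)
      show "continuous_on (ball 0 1) (\<lambda>z. F z - P z)"
        using DERIV_isCont[OF F] DERIV_isCont[OF P] ball_subset_Li3_slit_plane
        by (intro continuous_on_diff continuous_at_imp_continuous_on) (auto simp: S_def)
      show "\<forall>z\<in>ball 0 1 - {0}. ((\<lambda>z. F z - P z) has_field_derivative 0) (at z)"
      proof
        fix z :: complex assume z: "z \<in> ball 0 1 - {0}"
        have "((\<lambda>z. F z - P z) has_field_derivative g z - g z) (at z)"
          using F[of z] P[of z] g_sums[of z] z ball_subset_Li3_slit_plane
          by (intro DERIV_diff) (auto simp: S_def)
        then show "((\<lambda>z. F z - P z) has_field_derivative 0) (at z)" by simp
      qed
    qed auto
    then obtain k where k: "\<And>z. z \<in> ball 0 1 \<Longrightarrow> F z - P z = k"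
      unfolding constant_on_def by blast
    show ?thesis using k[OF z] k[of 0] by simp
  qed
  moreover have "P 0 = 0" unfolding P_def powser_zero by (simp add: c_def)
  moreover have "F 0 = 0" by (simp add: F_def)
  ultimately have "(\<lambda>k. c k * z ^ k) sums F z" if "z \<in> ball 0 1" for z
    using c_summable[of z] that by (simp add: sums_iff P_def)
  moreover have "F holomorphic_on S"
    using F open_Li3_slit_plane by (auto simp: S_def holomorphic_on_open)
  ultimately show ?thesis by (auto simp: S_def c_def)
qed

lemma Li3_continuation_ex:
  "\<exists>f. f holomorphic_on Li3_slit_plane \<and> (\<forall>u\<in>ball 0 1. f u = Li3_series u)"
proof -
  have "(\<lambda>z. 1 / (1 - z)) holomorphic_on Li3_slit_plane"
    by (intro holomorphic_intros) (auto simp: Li3_slit_plane_def image_iff)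
  moreover have "(\<lambda>k. 1 * z ^ k) sums (1 / (1 - z))" if "z \<in> ball 0 1" for z :: complex
    using geometric_sums[of z] that by simp
  ultimately obtain f1 where f1: "f1 holomorphic_on Li3_slit_plane"
      "\<And>z. z \<in> ball 0 1 \<Longrightarrow> (\<lambda>k. 1 / of_nat k * z ^ k) sums f1 z"
    using polylog_continuation_step[of "\<lambda>z. 1 / (1 - z)" "\<lambda>_. 1"] by auto
  obtain f2 where f2: "f2 holomorphic_on Li3_slit_plane"
      "\<And>z. z \<in> ball 0 1 \<Longrightarrow> (\<lambda>k. 1 / of_nat k / of_nat k * z ^ k) sums f2 z"
    using polylog_continuation_step[OF f1] by auto
  obtain f3 where f3: "f3 holomorphic_on Li3_slit_plane"
      "\<And>z. z \<in> ball 0 1 \<Longrightarrow> (\<lambda>k. 1 / of_nat k / of_nat k / of_nat k * z ^ k) sums f3 z"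
    using polylog_continuation_step[OF f2] by auto
  have "f3 z = Li3_series z" if "z \<in> ball 0 1" for z
  proof -
    have "(\<lambda>k. 1 / of_nat (Suc k) / of_nat (Suc k) / of_nat (Suc k) * z ^ Suc k) sums f3 z"
      using f3(2)[OF that]
        sums_Suc_iff[of "\<lambda>k. 1 / of_nat k / of_nat k / of_nat k * z ^ k" "f3 z"] by simp
    then show ?thesis
      by (simp add: Li3_series_def sums_iff power3_eq_cube mult.assoc del: of_nat_Suc)
  qed
  with f3(1) show ?thesis by blast
qed

lemma Li3_continuation_ex1:
  assumes "z \<in> Li3_slit_plane"
  shows "\<exists>!w. \<exists>f. f holomorphic_on Li3_slit_plane \<and>
                   (\<forall>u\<in>ball 0 1. f u = Li3_series u) \<and> w = f z"
proof -
  have unique: "f z = g z"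
    if f: "f holomorphic_on Li3_slit_plane" "\<forall>u\<in>ball 0 1. f u = Li3_series u"
      and g: "g holomorphic_on Li3_slit_plane" "\<forall>u\<in>ball 0 1. g u = Li3_series u" for f g
  proof (rule analytic_continuation_open[of "ball 0 1" Li3_slit_plane f g])
    show "connected Li3_slit_plane"
      by (rule starlike_imp_connected[OF starlike_Li3_slit_plane])
    show "f u = g u" if "u \<in> ball 0 1" for u using that f(2) g(2) by simp
  qed (use f(1) g(1) assms open_Li3_slit_plane ball_subset_Li3_slit_plane in simp_all)
  obtain f where f: "f holomorphic_on Li3_slit_plane" "\<forall>u\<in>ball 0 1. f u = Li3_series u"
    using Li3_continuation_ex by blast
  show ?thesis
  proof (rule ex1I[of _ "f z"])
    show "\<exists>h. h holomorphic_on Li3_slit_plane \<and> (\<forall>u\<in>ball 0 1. h u = Li3_series u) \<and> f z = h z"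
      using f by blast
    fix w
    assume "\<exists>h. h holomorphic_on Li3_slit_plane \<and> (\<forall>u\<in>ball 0 1. h u = Li3_series u) \<and> w = h z"
    then obtain h where h: "h holomorphic_on Li3_slit_plane"
      "\<forall>u\<in>ball 0 1. h u = Li3_series u" "w = h z" by blast
    show "w = f z" using unique[OF h(1,2) f] h(3) by simp
  qed
qed

end

theory Submission
  imports Defs "HOL-Real_Asymp.Real_Asymp"
begin

text \<open>
  Let \<open>R N = \<Sum>j\<ge>N. (-1)^j / (2j+1)\<close> be the tail of the Leibniz series. The digamma differences are
  \<open>4 (-1)^N R N\<close>, so up to sign \<open>\<Theta>\<^sub>2\<close> is the sum of \<open>R (l+d+1) / l\<^sup>2\<close> over \<open>l > m\<close>, where \<open>d = n - m\<close>.
  The terms with \<open>l \<le> m\<close> give the finite sums over \<open>k\<close>. For the full sum over \<open>l \<ge> 1\<close>, raising \<open>d\<close> by one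
  changes the value by an elementary amount (partial fractions), which reduces everything to
  \<open>\<Sum>l\<ge>1. R l / l\<^sup>2\<close>.

  Since \<open>R l\<close> is the integral of \<open>(-x\<^sup>2)^l / (1+x\<^sup>2)\<close> over \<open>[0,1]\<close>, this last sum is
  \<open>\<integral> Li\<^sub>2(-x\<^sup>2) / (1+x\<^sup>2) dx\<close>. Integrating by parts and using
  \<open>arctan x * ln (1+x\<^sup>2) = Im (Ln (1+ix)\<^sup>2)\<close> turns it into \<open>-\<pi>\<^sup>3/48 + 2 Im K(-i)\<close>, where
  \<open>K' = Ln(1-z)\<^sup>2 / z\<close> and \<open>K(0) = 0\<close>. Finally
  \<open>K(z) = Ln z Ln(1-z)\<^sup>2 + 2 Ln(1-z) Li\<^sub>2(1-z) - 2 Li\<^sub>3(1-z)\<close> up to a real constant, which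
  is evaluated at \<open>z = -i\<close> with the reflection formula for \<open>Li\<^sub>2\<close>.
\<close>

section \<open>Tails of the Leibniz series and the digamma function\<close>

definition leibniz_tail :: "nat \<Rightarrow> real" where
  "leibniz_tail N = pi / 4 - (\<Sum>j<N. (-1) ^ j / (2 * real j + 1))"

lemma leibniz_tail_Suc: "leibniz_tail (Suc N) = leibniz_tail N - (-1) ^ N / (2 * real N + 1)"
  by (simp add: leibniz_tail_def)

lemma Leibniz_sums: "(\<lambda>j. (-1) ^ j / (2 * real j + 1)) sums (pi / 4)"
proof -
  have "summable (\<lambda>k. (-1) ^ k * (1 / real (k * 2 + 1) * 1 ^ (k * 2 + 1)))"
    by (rule summable_arctan_series) simp
  then have "summable (\<lambda>j. (-1) ^ j / (2 * real j + 1))"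
    by (simp add: mult.commute add.commute)
  with pi_series show ?thesis
    by (simp add: sums_iff mult.commute add.commute)
qed

text \<open>The factor \<open>(-1) ^ N\<close> makes the series start with a positive term, which is
  the normalisation the partial fraction expansion produces later.\<close>

lemma leibniz_tail_sums:
  "(\<lambda>k. (-1) ^ k / (2 * real (k + N) + 1)) sums ((-1) ^ N * leibniz_tail N)"
proof -
  have "(\<lambda>k. (-1) ^ (k + N) / (2 * real (k + N) + 1)) sums leibniz_tail N"
    using sums_split_initial_segment[OF Leibniz_sums, of N] by (simp add: leibniz_tail_def)
  then have "(\<lambda>k. (-1) ^ N * ((-1) ^ (k + N) / (2 * real (k + N) + 1))) sums ((-1) ^ N * leibniz_tail N)"
    by (rule sums_mult)
  moreover have "(-1) ^ N * ((-1) ^ (k + N) / (2 * real (k + N) + 1)) = (-1) ^ k / (2 * real (k + N) + 1)" for k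
    by (cases "even N") (simp_all add: power_add)
  ultimately show ?thesis by (simp only:)
qed

text \<open>Pairing consecutive terms of four times the Leibniz series gives 1/(n+1/4) - 1/(n+3/4).
  In the difference of the two limit formulas for \<open>Digamma\<close> the logarithms cancel, and
  the same series is left.\<close>

lemma Digamma_three_quarters_minus_quarter: "Digamma (3 / 4) - Digamma (1 / 4 :: real) = pi"
proof -
  have "(\<lambda>j. 4 * ((-1) ^ j / (2 * real j + 1))) sums (4 * (pi / 4))"
    by (intro sums_mult Leibniz_sums)
  from sums_group[OF this, of 2]
  have "(\<lambda>n. inverse (1/4 + real n) - inverse (3/4 + real n)) sums pi"
    by (simp add: atLeastLessThanSuc eval_nat_numeral power_mult inverse_eq_divide)
       (simp add: field_simps)
  moreover have "(\<lambda>m. (\<Sum>n<m. inverse (1/4 + real n) - inverse (3/4 + real n)))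
                   \<longlonglongrightarrow> Digamma (3 / 4) - Digamma (1 / 4 :: real)"
    using tendsto_diff[OF Digamma_LIMSEQ[of "3/4::real"] Digamma_LIMSEQ[of "1/4::real"]]
    by (simp add: sum_subtractf)
  ultimately show ?thesis
    unfolding sums_def by (rule LIMSEQ_unique[symmetric])
qed

text \<open>Passing from N to N+1 turns the old upper argument into the new lower one, while the new
  upper argument is the old lower one plus 1. So psi(x+1) = psi(x) + 1/x flips the sign of the
  difference and adds 4/(2N+1), exactly as the tail recursion does.\<close>

lemma Digamma_diff_eq_leibniz_tail:
  "Digamma ((2 * real N + 3) / 4) - Digamma ((2 * real N + 1) / 4) = 4 * (-1) ^ N * leibniz_tail N"
proof (induction N)
  case 0
  then show ?case
    using Digamma_three_quarters_minus_quarter by (simp add: leibniz_tail_def)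
next
  case (Suc N)
  have "Digamma ((2 * real N + 1) / 4 + 1) = Digamma ((2 * real N + 1) / 4) + 1 / ((2 * real N + 1) / 4)"
    by (rule Digamma_plus1) simp
  then have "Digamma ((2 * real (Suc N) + 3) / 4) = Digamma ((2 * real N + 1) / 4) + 4 / (2 * real N + 1)"
    by (simp add: field_simps)
  moreover have "(2 * real (Suc N) + 1) / 4 = (2 * real N + 3) / 4" by simp
  moreover have "a + y - b = y - z" if "b - a = z" for a b y z :: real
    using that by simp
  ultimately have "Digamma ((2 * real (Suc N) + 3) / 4) - Digamma ((2 * real (Suc N) + 1) / 4)
      = 4 / (2 * real N + 1) - 4 * (-1) ^ N * leibniz_tail N"
    using Suc by (simp only:)
  also have "\<dots> = 4 * (-1) ^ Suc N * leibniz_tail (Suc N)"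
    by (cases "even N") (simp_all add: leibniz_tail_Suc algebra_simps)
  finally show ?case .
qed

text \<open>The alternating sign of the series and that of the digamma difference combine to a sign
  free of k, and the factor 4 cancels against the square of 2(k+m+1).\<close>

lemma Theta2_term_eq:
  "Theta2_term m n (Suc k) = (-1) ^ Suc n * (leibniz_tail (k + n + 2) / (real (k + m) + 1) ^ 2)"
proof -
  have "(2 * real (Suc k) + 2 * real n + 5) / 4 = (2 * real (k + n + 2) + 3) / 4"
    "(2 * real (Suc k) + 2 * real n + 3) / 4 = (2 * real (k + n + 2) + 1) / 4"
    by simp_all
  then have "Theta2_term m n (Suc k)
      = (-1) ^ Suc k * (4 * (-1) ^ (k + n + 2) * leibniz_tail (k + n + 2)) / (2 * (real (k + m) + 1)) ^ 2"
    by (simp only: Theta2_term_def Digamma_diff_eq_leibniz_tail) (simp add: algebra_simps)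
  also have "\<dots> = ((-1) ^ Suc k * (-1) ^ (k + n + 2)) * leibniz_tail (k + n + 2) / (real (k + m) + 1) ^ 2"
    unfolding power_mult_distrib by simp
  also have "(-1) ^ Suc k * (-1) ^ (k + n + 2) = ((-1) ^ Suc n :: real)"
    by (simp add: power_add)
  finally show ?thesis by simp
qed

section \<open>Polylogarithm series on the closed unit disc\<close>

definition polylog_series :: "nat \<Rightarrow> complex \<Rightarrow> complex" where
  "polylog_series s z = (\<Sum>k. z ^ Suc k / of_nat (Suc k) ^ s)"

lemma Li3_series_eq: "Li3_series = polylog_series 3"
  by (simp add: fun_eq_iff Li3_series_def polylog_series_def)

lemma summable_inverse_Suc_power:
  assumes "s \<ge> 2"
  shows "summable (\<lambda>k. 1 / real (Suc k) ^ s)"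
  using inverse_power_summable[OF assms, where ?'a = real]
  by (subst summable_Suc_iff) (simp add: inverse_eq_divide)

lemma norm_polylog_term_le:
  assumes "norm (z :: complex) \<le> 1"
  shows "norm (z ^ Suc k / of_nat (Suc k) ^ s) \<le> 1 / real (Suc k) ^ s"
  using power_le_one[OF _ assms, of "Suc k"]
  by (simp add: norm_divide norm_power norm_mult divide_right_mono del: of_nat_Suc power_Suc)

lemma polylog_series_sums:
  assumes "norm z \<le> 1" "s \<ge> 2"
  shows "(\<lambda>k. z ^ Suc k / of_nat (Suc k) ^ s) sums polylog_series s z"
  unfolding polylog_series_def
  by (intro summable_sums summable_comparison_test'[OF summable_inverse_Suc_power[OF assms(2)]]
        norm_polylog_term_le[OF assms(1)])

text \<open>The Weierstrass bound 1/k^s holds on the closed disc, so continuity reaches the unit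
  circle, where the special values at -1, -i and 1 are taken.\<close>

lemma continuous_on_polylog_series:
  assumes "s \<ge> 2"
  shows "continuous_on (cball 0 1) (polylog_series s)"
proof (rule uniform_limit_theorem)
  show "uniform_limit (cball 0 1) (\<lambda>n z. \<Sum>k<n. z ^ Suc k / of_nat (Suc k) ^ s) (polylog_series s) sequentially"
    unfolding polylog_series_def
    by (rule Weierstrass_m_test[OF norm_polylog_term_le summable_inverse_Suc_power[OF assms]]) simp
qed (auto intro!: continuous_intros always_eventually simp del: of_nat_Suc)

text \<open>Termwise differentiation lowers the order by one. Multiplying by z instead of dividing
  keeps the second claim valid at 0.\<close>

lemma polylog_series_deriv:
  assumes z: "norm z < 1"
  shows "(polylog_series (Suc s) has_field_derivative (\<Sum>k. z ^ k / of_nat (Suc k) ^ s)) (at z)"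
    and "z * (\<Sum>k. z ^ k / of_nat (Suc k) ^ s) = polylog_series s z"
proof -
  \<comment> \<open>Here \<open>c 0\<close> is 0 by the convention for division by zero, so this
    power series has no constant term.\<close>
  define c :: "nat \<Rightarrow> complex" where "c k = 1 / of_nat k ^ Suc s" for k
  have summ: "summable (\<lambda>k. c k * w ^ k)" if "norm w < 1" for w
  proof (rule summable_comparison_test'[OF summable_geometric[of "norm w"]])
    fix k
    have "norm (c k) \<le> 1"
      by (cases k) (auto simp: c_def norm_divide norm_power norm_mult divide_le_eq_1 simp del: of_nat_Suc power_Suc)
    then show "norm (c k * w ^ k) \<le> norm w ^ k"
      by (simp add: norm_mult norm_power mult_left_le_one_le)
  qed (use that in auto)
  have eq: "(\<Sum>k. c k * w ^ k) = polylog_series (Suc s) w" if "norm w < 1" for w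
    using suminf_split_head[OF summ[OF that]] by (simp add: c_def polylog_series_def)
  have d: "diffs c k = 1 / of_nat (Suc k) ^ s" for k
    by (simp add: diffs_def c_def del: of_nat_Suc)
  have "((\<lambda>w. \<Sum>k. c k * w ^ k) has_field_derivative (\<Sum>k. diffs c k * z ^ k)) (at z)"
    by (rule termdiffs_strong'[OF summ z])
  then have "((\<lambda>w. \<Sum>k. c k * w ^ k) has_field_derivative (\<Sum>k. z ^ k / of_nat (Suc k) ^ s)) (at z)"
    by (simp add: d del: of_nat_Suc)
  then show "(polylog_series (Suc s) has_field_derivative (\<Sum>k. z ^ k / of_nat (Suc k) ^ s)) (at z)"
    by (rule has_field_derivative_transform_within_open[where S = "ball 0 1"]) (use z eq in auto)
  have "summable (\<lambda>k. diffs c k * z ^ k)"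
    by (rule termdiff_converges[OF z summ])
  then have "summable (\<lambda>k. z ^ k / of_nat (Suc k) ^ s)"
    by (simp add: d del: of_nat_Suc)
  from suminf_mult[OF this, of z] show "z * (\<Sum>k. z ^ k / of_nat (Suc k) ^ s) = polylog_series s z"
    by (simp add: polylog_series_def del: of_nat_Suc)
qed

lemma polylog_series_1: "norm z < 1 \<Longrightarrow> polylog_series 1 z = - Ln (1 - z)"
proof -
  assume z: "norm z < 1"
  then have "(\<lambda>n. - (z ^ n) / of_nat n) sums Ln (1 - z)"
    using Ln_series'[of "- z"] by simp
  then have "(\<lambda>n. z ^ n / of_nat n) sums - Ln (1 - z)"
    using sums_minus by fastforce
  then have "(\<lambda>n. z ^ Suc n / of_nat (Suc n)) sums - Ln (1 - z)"
    using sums_Suc_iff[of "\<lambda>n. z ^ n / of_nat n"] by simp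
  then show ?thesis by (simp add: polylog_series_def sums_iff)
qed

lemma polylog_series_cnj:
  assumes "norm z \<le> 1" "s \<ge> 2"
  shows "polylog_series s (cnj z) = cnj (polylog_series s z)"
proof -
  have "(\<lambda>k. cnj (z ^ Suc k / of_nat (Suc k) ^ s)) sums cnj (polylog_series s z)"
    unfolding sums_cnj by (rule polylog_series_sums[OF assms])
  then have "(\<lambda>k. cnj z ^ Suc k / of_nat (Suc k) ^ s) sums cnj (polylog_series s z)"
    by simp
  with polylog_series_sums[of "cnj z" s] assms show ?thesis
    using sums_unique2 by auto
qed

lemma polylog_series_of_real_in_Reals:
  assumes "\<bar>x\<bar> \<le> 1" "s \<ge> 2"
  shows "polylog_series s (of_real x) \<in> \<real>"
  using polylog_series_cnj[of "of_real x" s] assms by (simp add: Reals_cnj_iff)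

text \<open>Adding the series at z and -z cancels the odd powers and doubles the even ones; writing
  an even exponent as 2k pulls out 2^s from the denominator.\<close>

lemma polylog_series_duplication:
  assumes "norm z \<le> 1" "s \<ge> 2"
  shows "polylog_series s (z ^ 2) = 2 ^ (s - 1) * (polylog_series s z + polylog_series s (- z))"
proof -
  define t where "t k = z ^ Suc k / of_nat (Suc k) ^ s + (- z) ^ Suc k / of_nat (Suc k) ^ s" for k
  have t: "t sums (polylog_series s z + polylog_series s (- z))"
    unfolding t_def using assms by (intro sums_add polylog_series_sums) auto
  \<comment> \<open>Index k carries the power k+1, so the surviving even powers sit at odd
    indices.\<close>
  have "strict_mono (\<lambda>k::nat. 2 * k + 1)"
    by (rule strict_monoI) simp
  moreover have "t n = 0" if "n \<notin> range (\<lambda>k. 2 * k + 1)" for n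
    using that by (cases "even n") (auto simp: t_def elim!: oddE)
  ultimately have "(\<lambda>k. t (2 * k + 1)) sums (polylog_series s z + polylog_series s (- z))"
    using t by (subst sums_mono_reindex)
  from sums_mult[OF this, of "2 ^ (s - 1)"]
  have "(\<lambda>k. 2 ^ (s - 1) * t (2 * k + 1)) sums (2 ^ (s - 1) * (polylog_series s z + polylog_series s (- z)))" .
  moreover have "2 ^ (s - 1) * t (2 * k + 1) = (z ^ 2) ^ Suc k / of_nat (Suc k) ^ s" for k
  proof -
    have "Suc (2 * k + 1) = 2 * Suc k" by simp
    then have "t (2 * k + 1) = 2 * (z ^ 2) ^ Suc k / (2 ^ s * of_nat (Suc k) ^ s)"
      unfolding t_def by (simp only: power_mult power2_minus of_nat_mult power_mult_distrib) simp
    moreover have "(2::complex) ^ s = 2 * 2 ^ (s - 1)"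
      using assms(2) by (cases s) auto
    ultimately show ?thesis by (simp del: of_nat_Suc power_Suc)
  qed
  ultimately have "(\<lambda>k. (z ^ 2) ^ Suc k / of_nat (Suc k) ^ s) sums
      (2 ^ (s - 1) * (polylog_series s z + polylog_series s (- z)))"
    by (simp only:)
  moreover have "norm (z ^ 2) \<le> 1"
    using assms(1) by (simp add: norm_power power_le_one)
  ultimately show ?thesis
    using polylog_series_sums[OF _ assms(2)] sums_unique2 by blast
qed

section \<open>Special values of the dilogarithm series\<close>

lemma polylog_series_2_1: "polylog_series 2 1 = of_real (pi ^ 2 / 6)"
proof -
  have "(\<lambda>n. complex_of_real (1 / (real n + 1) ^ 2)) sums of_real (pi ^ 2 / 6)"
    using inverse_squares_sums by (intro sums_of_real) (simp add: add.commute)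
  then show ?thesis by (simp add: polylog_series_def sums_iff add.commute)
qed

lemma polylog_series_2_minus_1: "polylog_series 2 (- 1) = - of_real (pi ^ 2 / 12)"
  using polylog_series_duplication[of 1 2] by (simp add: polylog_series_2_1 complex_eq_iff)

lemma Catalan_G_sums: "(\<lambda>k. (-1) ^ k / (2 * real k + 1) ^ 2) sums Catalan_G"
  unfolding Catalan_G_def
proof (intro summable_sums summable_comparison_test'[OF summable_inverse_Suc_power[OF order_refl]])
  fix k :: nat
  have "real (Suc k) ^ 2 \<le> (2 * real k + 1) ^ 2"
    by (intro power_mono) auto
  then show "norm ((-1) ^ k / (2 * real k + 1) ^ 2) \<le> 1 / real (Suc k) ^ 2"
    by (simp add: norm_divide norm_power divide_left_mono del: of_nat_Suc)
qed

text \<open>The real part comes from duplication at i, since the values at i and -i are conjugate.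
  For the imaginary part only odd powers of -i contribute, and they form the Catalan series with a
  minus sign.\<close>

lemma polylog_series_2_minus_ii:
  "polylog_series 2 (- \<i>) = - of_real (pi ^ 2 / 48) - \<i> * of_real Catalan_G"
proof (rule complex_eqI)
  have "polylog_series 2 (- \<i>) = cnj (polylog_series 2 \<i>)"
    using polylog_series_cnj[of \<i> 2] by simp
  moreover have "polylog_series 2 (- 1) = 2 * (polylog_series 2 \<i> + polylog_series 2 (- \<i>))"
    using polylog_series_duplication[of \<i> 2] by simp
  ultimately have "- (pi ^ 2 / 12) = 4 * Re (polylog_series 2 (- \<i>))"
    by (simp add: polylog_series_2_minus_1 complex_eq_iff)
  then show "Re (polylog_series 2 (- \<i>)) = Re (- of_real (pi ^ 2 / 48) - \<i> * of_real Catalan_G)"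
    by simp
  have "(\<lambda>k. Im ((- \<i>) ^ Suc k / of_nat (Suc k) ^ 2)) sums Im (polylog_series 2 (- \<i>))"
    by (intro sums_Im polylog_series_sums) auto
  moreover have "strict_mono (\<lambda>k::nat. 2 * k)"
    by (rule strict_monoI) simp
  moreover have "Im ((- \<i>) ^ Suc n / of_nat (Suc n) ^ 2) = 0" if "n \<notin> range (\<lambda>k. 2 * k)" for n
  proof -
    have "odd n" using that by (auto elim!: evenE)
    then obtain k where "Suc n = 2 * k"
      by (metis even_Suc evenE)
    moreover have "(- \<i>) ^ (2 * k) = of_real ((-1) ^ k)"
      by (simp add: power_mult)
    moreover have "complex_of_nat (Suc n) ^ 2 = of_real (real (Suc n) ^ 2)"
      by simp
    ultimately have "(- \<i>) ^ Suc n / of_nat (Suc n) ^ 2 = of_real ((-1) ^ k / real (Suc n) ^ 2)"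
      by (simp only: of_real_divide)
    then show ?thesis by (simp only: Im_complex_of_real)
  qed
  ultimately have "(\<lambda>k. Im ((- \<i>) ^ Suc (2 * k) / of_nat (Suc (2 * k)) ^ 2)) sums Im (polylog_series 2 (- \<i>))"
    by (subst sums_mono_reindex)
  moreover have "Im ((- \<i>) ^ Suc (2 * k) / of_nat (Suc (2 * k)) ^ 2) = - ((-1) ^ k / (2 * real k + 1) ^ 2)" for k
  proof -
    have "(- \<i>) ^ Suc (2 * k) = - \<i> * of_real ((-1) ^ k)"
      by (simp add: power_mult)
    moreover have "complex_of_nat (Suc (2 * k)) ^ 2 = of_real ((2 * real k + 1) ^ 2)"
      by (simp add: add.commute)
    ultimately have "(- \<i>) ^ Suc (2 * k) / of_nat (Suc (2 * k)) ^ 2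
        = - \<i> * of_real ((-1) ^ k / (2 * real k + 1) ^ 2)"
      by (simp only: of_real_divide times_divide_eq_right)
    then show ?thesis by simp
  qed
  ultimately have "(\<lambda>k. - ((-1) ^ k / (2 * real k + 1) ^ 2)) sums Im (polylog_series 2 (- \<i>))"
    by (simp only:)
  with sums_minus[OF Catalan_G_sums] have "Im (polylog_series 2 (- \<i>)) = - Catalan_G"
    using sums_unique2 by blast
  then show "Im (polylog_series 2 (- \<i>)) = Im (- of_real (pi ^ 2 / 48) - \<i> * of_real Catalan_G)"
    by simp
qed

section \<open>Dilogarithm and trilogarithm on the slit plane\<close>

lemma Li3_slit_plane_iff: "z \<in> Li3_slit_plane \<longleftrightarrow> Im z \<noteq> 0 \<or> Re z < 1"
  by (auto simp: Li3_slit_plane_def image_iff complex_eq_iff not_le)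

lemma one_minus_notin_nonpos_Reals: "z \<in> Li3_slit_plane \<Longrightarrow> 1 - z \<notin> \<real>\<^sub>\<le>\<^sub>0"
  by (auto simp: Li3_slit_plane_iff complex_nonpos_Reals_iff)

text \<open>Both sides agree along the radial sequence n/(n+1) z inside the disc. The left side is
  continuous on the slit plane and the series on the closed disc, so the limits agree.\<close>

lemma polylog_boundary_value:
  assumes f: "f holomorphic_on Li3_slit_plane" "\<And>u. u \<in> ball 0 1 \<Longrightarrow> f u = polylog_series s u"
    and s: "s \<ge> 2" and z: "z \<in> Li3_slit_plane" "norm z \<le> 1"
  shows "f z = polylog_series s z"
proof -
  define X where "X n = of_real (real n / real (Suc n)) * z" for n
  have "X \<longlonglongrightarrow> of_real 1 * z"
    unfolding X_def by (intro tendsto_intros LIMSEQ_n_over_Suc_n)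
  then have X: "X \<longlonglongrightarrow> z" by simp
  have X_ball: "X n \<in> ball 0 1" for n
  proof -
    have "norm (X n) = real n / real (Suc n) * norm z"
      unfolding X_def norm_mult norm_of_real by simp
    also have "\<dots> \<le> real n / real (Suc n)"
      by (rule mult_left_le[OF z(2)]) simp
    also have "\<dots> < 1" by simp
    finally show ?thesis by simp
  qed
  have "X n \<in> Li3_slit_plane" for n
    using X_ball ball_subset_Li3_slit_plane by blast
  then have "(\<lambda>n. f (X n)) \<longlonglongrightarrow> f z"
    using z by (intro continuous_on_tendsto_compose[OF holomorphic_on_imp_continuous_on[OF f(1)] X]) auto
  moreover have "(\<lambda>n. polylog_series s (X n)) \<longlonglongrightarrow> polylog_series s z"
    using X_ball z by (intro continuous_on_tendsto_compose[OF continuous_on_polylog_series[OF s] X])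
      (auto intro!: always_eventually less_imp_le)
  ultimately show ?thesis
    using f(2)[OF X_ball] LIMSEQ_unique by auto
qed

text \<open>Reconciles the two branches of the definition of \<open>Li3\<close>: on the closed disc
  the series equals the continuation by the boundary argument, and outside it the continuation is
  unique. Holomorphy of \<open>Li3\<close> across the unit circle follows.\<close>

lemma Li3_eqI:
  assumes "f holomorphic_on Li3_slit_plane" "\<forall>u\<in>ball 0 1. f u = Li3_series u" "z \<in> Li3_slit_plane"
  shows "Li3 z = f z"
proof (cases "norm z \<le> 1")
  case True
  then show ?thesis
    using polylog_boundary_value[of f 3 z] assms by (simp add: Li3_def Li3_series_eq)
next
  case False
  then show ?thesis
    unfolding Li3_def using the1_equality[OF Li3_continuation_ex1[OF assms(3)]] assms(1,2) by auto
qed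

lemma Li3_ball: "u \<in> ball 0 1 \<Longrightarrow> Li3 u = polylog_series 3 u"
  by (simp add: Li3_def Li3_series_eq)

lemma holomorphic_Li3: "Li3 holomorphic_on Li3_slit_plane"
proof -
  obtain f where "f holomorphic_on Li3_slit_plane" "\<forall>u\<in>ball 0 1. f u = Li3_series u"
    using Li3_continuation_ex by blast
  then show ?thesis
    using Li3_eqI by (subst holomorphic_cong[OF refl, where g = f]) auto
qed

text \<open>The dilogarithm on the slit plane; defined this way it needs no continuation argument of its own.\<close>

definition Li2 :: "complex \<Rightarrow> complex" where
  "Li2 z = z * deriv Li3 z"

lemma holomorphic_Li2: "Li2 holomorphic_on Li3_slit_plane"
  unfolding Li2_def by (intro holomorphic_intros holomorphic_deriv holomorphic_Li3 open_Li3_slit_plane)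

lemma polylog_series_deriv_ball:
  assumes "\<And>u. u \<in> ball 0 1 \<Longrightarrow> f u = polylog_series (Suc s) u" "z \<in> ball 0 1"
  shows "z * deriv f z = polylog_series s z"
proof -
  have "(f has_field_derivative (\<Sum>k. z ^ k / of_nat (Suc k) ^ s)) (at z)"
    using assms by (intro has_field_derivative_transform_within_open[OF polylog_series_deriv(1), of z "ball 0 1"]) auto
  then show ?thesis
    using polylog_series_deriv(2)[of z s] assms(2) by (simp add: DERIV_imp_deriv)
qed

lemma Li2_ball: "u \<in> ball 0 1 \<Longrightarrow> Li2 u = polylog_series 2 u"
  unfolding Li2_def by (rule polylog_series_deriv_ball) (simp_all add: Li3_ball eval_nat_numeral)

lemma Li2_eq_polylog_series:
  "z \<in> Li3_slit_plane \<Longrightarrow> norm z \<le> 1 \<Longrightarrow> Li2 z = polylog_series 2 z"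
  by (rule polylog_boundary_value[OF holomorphic_Li2 Li2_ball]) simp_all

lemma Li3_has_field_derivative:
  assumes "z \<in> Li3_slit_plane" "z \<noteq> 0"
  shows "(Li3 has_field_derivative Li2 z / z) (at z)"
  using holomorphic_derivI[OF holomorphic_Li3 open_Li3_slit_plane assms(1)] assms(2) by (simp add: Li2_def)

text \<open>On the unit disc z Li2'(z) is the series of order 1, that is -Ln(1-z). Both sides are
  holomorphic on the connected slit plane, so the identity theorem extends this.\<close>

lemma Li2_has_field_derivative:
  assumes "z \<in> Li3_slit_plane" "z \<noteq> 0"
  shows "(Li2 has_field_derivative - Ln (1 - z) / z) (at z)"
proof -
  have "z * deriv Li2 z = - Ln (1 - z)"
  proof (rule analytic_continuation_open[of "ball 0 1" Li3_slit_plane "\<lambda>z. z * deriv Li2 z" "\<lambda>z. - Ln (1 - z)"])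
    show "connected Li3_slit_plane"
      by (rule starlike_imp_connected[OF starlike_Li3_slit_plane])
    show "(\<lambda>z. z * deriv Li2 z) holomorphic_on Li3_slit_plane"
      by (intro holomorphic_intros holomorphic_deriv holomorphic_Li2 open_Li3_slit_plane)
    show "(\<lambda>z. - Ln (1 - z)) holomorphic_on Li3_slit_plane"
      by (intro holomorphic_intros one_minus_notin_nonpos_Reals)
    show "u * deriv Li2 u = - Ln (1 - u)" if "u \<in> ball 0 1" for u
      using polylog_series_deriv_ball[of Li2 1 u] polylog_series_1[of u] that
      by (simp add: Li2_ball eval_nat_numeral)
  qed (use assms open_Li3_slit_plane ball_subset_Li3_slit_plane in auto)
  then have "deriv Li2 z = - Ln (1 - z) / z"
    using assms(2) by (simp add: field_simps)
  then show ?thesis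
    using holomorphic_derivI[OF holomorphic_Li2 open_Li3_slit_plane assms(1)] by simp
qed

section \<open>The symmetry between z and 1-z, and the reflection formula\<close>

text \<open>The complex plane without the real rays up to 0 and from 1 on. It is invariant under z
  -> 1-z, and both logarithms and all polylogarithms at z and 1-z are holomorphic on it.\<close>

definition doubly_slit_plane :: "complex set" where
  "doubly_slit_plane = {z. z \<in> Li3_slit_plane \<and> 1 - z \<in> Li3_slit_plane}"

lemma doubly_slit_plane_iff: "z \<in> doubly_slit_plane \<longleftrightarrow> Im z \<noteq> 0 \<or> 0 < Re z \<and> Re z < 1"
  by (auto simp: doubly_slit_plane_def Li3_slit_plane_iff)

lemma doubly_slit_planeD:
  assumes "z \<in> doubly_slit_plane"
  shows "z \<in> Li3_slit_plane" "1 - z \<in> Li3_slit_plane" "z \<noteq> 0" "1 - z \<noteq> 0"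
    "z \<notin> \<real>\<^sub>\<le>\<^sub>0" "1 - z \<notin> \<real>\<^sub>\<le>\<^sub>0"
  using assms one_minus_notin_nonpos_Reals[of z] one_minus_notin_nonpos_Reals[of "1 - z"]
  by (auto simp: doubly_slit_plane_def zero_in_Li3_slit_plane Li3_slit_plane_iff)

lemma open_doubly_slit_plane: "open doubly_slit_plane"
proof -
  have "doubly_slit_plane = Li3_slit_plane \<inter> (\<lambda>z. 1 - z) -` Li3_slit_plane"
    by (auto simp: doubly_slit_plane_def)
  moreover have "open ((\<lambda>z. 1 - z) -` Li3_slit_plane)"
    by (intro open_vimage open_Li3_slit_plane continuous_intros)
  ultimately show ?thesis using open_Li3_slit_plane by (metis open_Int)
qed

text \<open>The set is star-shaped about 1/2: segments to nonreal points meet the real line only in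
  the centre, and segments to real points stay within (0,1).\<close>

lemma connected_doubly_slit_plane: "connected doubly_slit_plane"
proof (rule starlike_imp_connected)
  show "starlike doubly_slit_plane"
    unfolding starlike_def
  proof (intro bexI[of _ "1 / 2"] ballI subsetI)
    fix z w assume z: "z \<in> doubly_slit_plane" and "w \<in> closed_segment (1 / 2) z"
    then obtain t where t: "0 \<le> t" "t \<le> 1" and w: "w = (1 - t) *\<^sub>R (1 / 2) + t *\<^sub>R z"
      by (auto simp: closed_segment_def)
    have Re: "Re w = (1 - t) / 2 + t * Re z" and Im: "Im w = t * Im z"
      by (simp_all add: w)
    show "w \<in> doubly_slit_plane"
    proof (cases "t = 0 \<or> Im z \<noteq> 0")
      case True
      then show ?thesis using Re Im by (auto simp: doubly_slit_plane_iff)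
    next
      case False
      with z have "0 < Re z" "Re z < 1" "t > 0" using t by (auto simp: doubly_slit_plane_iff)
      then have "0 < t * Re z" "t * Re z < t" by simp_all
      then have "0 < Re w \<and> Re w < 1" using t unfolding Re by (auto simp: field_simps)
      then show ?thesis by (simp add: doubly_slit_plane_iff)
    qed
  qed (simp add: doubly_slit_plane_iff)
qed

lemma constant_on_doubly_slit_plane:
  assumes "\<And>z. z \<in> doubly_slit_plane \<Longrightarrow> (f has_field_derivative 0) (at z)"
  shows "\<exists>c. \<forall>z\<in>doubly_slit_plane. f z = c"
proof -
  have "f constant_on doubly_slit_plane"
  proof (rule DERIV_zero_connected_constant_on[where K = "{}"])
    show "continuous_on doubly_slit_plane f"
      using DERIV_isCont[OF assms] by (intro continuous_at_imp_continuous_on) auto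
  qed (use assms open_doubly_slit_plane connected_doubly_slit_plane in auto)
  then show ?thesis unfolding constant_on_def by auto
qed

lemma Li2_one_minus_deriv:
  assumes "z \<in> doubly_slit_plane"
  shows "((\<lambda>z. Li2 (1 - z)) has_field_derivative Ln z / (1 - z)) (at z)"
    and "((\<lambda>z. Li3 (1 - z)) has_field_derivative - Li2 (1 - z) / (1 - z)) (at z)"
proof -
  note D = doubly_slit_planeD[OF assms]
  have d: "((\<lambda>z. 1 - z) has_field_derivative - 1) (at z)"
    by (auto intro!: derivative_eq_intros)
  show "((\<lambda>z. Li2 (1 - z)) has_field_derivative Ln z / (1 - z)) (at z)"
    using DERIV_chain2[OF Li2_has_field_derivative[OF D(2,4)] d] by simp
  show "((\<lambda>z. Li3 (1 - z)) has_field_derivative - Li2 (1 - z) / (1 - z)) (at z)"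
    using DERIV_chain2[OF Li3_has_field_derivative[OF D(2,4)] d] by simp
qed

text \<open>Euler's reflection formula. The derivatives of the dilogarithms cancel those of the
  product of logarithms, so the left side is constant on a connected domain.\<close>

lemma Li2_reflection:
  assumes "z \<in> doubly_slit_plane"
  shows "Li2 (1 - z) + Li2 z + Ln z * Ln (1 - z) = of_real (pi ^ 2 / 6)"
proof -
  let ?f = "\<lambda>z. Li2 (1 - z) + Li2 z + Ln z * Ln (1 - z)"
  have "(?f has_field_derivative 0) (at z)" if z: "z \<in> doubly_slit_plane" for z
  proof -
    note D = doubly_slit_planeD[OF z]
    have "(?f has_field_derivative Ln z / (1 - z) + - Ln (1 - z) / z
        + (Ln z * (- 1 / (1 - z)) + 1 / z * Ln (1 - z))) (at z)"
      using D by (auto intro!: DERIV_add DERIV_mult' Li2_one_minus_deriv(1)[OF z] Li2_has_field_derivative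
          derivative_eq_intros simp: divide_inverse)
    then show ?thesis by (simp add: algebra_simps)
  qed
  then obtain c where c: "\<And>z. z \<in> doubly_slit_plane \<Longrightarrow> ?f z = c"
    using constant_on_doubly_slit_plane[of ?f] by blast
  \<comment> \<open>The constant is found as the limit z -> 0 along positive reals, where the
    product of logarithms tends to 0 and only Li2(1) remains.\<close>
  define X where "X n = 1 / (real n + 2)" for n
  have X: "0 < X n" "X n < 1" for n by (simp_all add: X_def)
  have X_le: "\<bar>X n\<bar> \<le> 1" "\<bar>1 - X n\<bar> \<le> 1" for n
    using X[of n] by auto
  have X0: "X \<longlonglongrightarrow> 0" unfolding X_def by real_asymp
  \<comment> \<open>The limit point 1 lies on the cut, so the limits use continuity of the series on
    the closed disc rather than that of \<open>Li2\<close>.\<close>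
  have P: "(\<lambda>n. polylog_series 2 (of_real (Y n))) \<longlonglongrightarrow> polylog_series 2 (of_real y)"
    if Y: "Y \<longlonglongrightarrow> y" "\<And>n. \<bar>Y n\<bar> \<le> 1" "\<bar>y\<bar> \<le> 1" for Y :: "nat \<Rightarrow> real" and y
  proof (rule continuous_on_tendsto_compose[OF continuous_on_polylog_series[OF order_refl]])
    show "(\<lambda>n. complex_of_real (Y n)) \<longlonglongrightarrow> of_real y" by (rule tendsto_of_real[OF Y(1)])
  qed (simp_all add: Y(2,3))
  have "(\<lambda>n. polylog_series 2 (of_real (1 - X n))) \<longlonglongrightarrow> polylog_series 2 (of_real 1)"
    by (rule P) (use X_le tendsto_diff[OF tendsto_const X0, of 1] in auto)
  moreover have "(\<lambda>n. polylog_series 2 (of_real (X n))) \<longlonglongrightarrow> polylog_series 2 (of_real 0)"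
    by (rule P) (use X_le X0 in auto)
  moreover have "(\<lambda>n. of_real (ln (X n) * ln (1 - X n))) \<longlonglongrightarrow> complex_of_real 0"
    unfolding X_def by (intro tendsto_of_real) real_asymp
  ultimately have "(\<lambda>n. polylog_series 2 (of_real (1 - X n)) + polylog_series 2 (of_real (X n))
        + of_real (ln (X n) * ln (1 - X n)))
      \<longlonglongrightarrow> polylog_series 2 (of_real 1) + polylog_series 2 (of_real 0) + complex_of_real 0"
    by (intro tendsto_add)
  moreover have "polylog_series 2 (of_real (1 - X n)) + polylog_series 2 (of_real (X n))
        + of_real (ln (X n) * ln (1 - X n)) = c" for n
  proof -
    have "?f (of_real (X n)) = c"
      using X[of n] by (intro c) (simp add: doubly_slit_plane_iff)
    moreover have "1 - complex_of_real (X n) = of_real (1 - X n)" by simp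
    moreover have "Ln (of_real (X n)) = of_real (ln (X n))" "Ln (of_real (1 - X n)) = of_real (ln (1 - X n))"
      using X[of n] by (auto intro!: Ln_of_real simp del: of_real_diff)
    moreover have "Li2 (of_real (X n)) = polylog_series 2 (of_real (X n))"
      "Li2 (of_real (1 - X n)) = polylog_series 2 (of_real (1 - X n))"
      using X[of n] by (auto intro!: Li2_ball simp del: of_real_diff)
    ultimately show ?thesis by (simp only: of_real_mult)
  qed
  ultimately have "(\<lambda>n. c) \<longlonglongrightarrow> polylog_series 2 (of_real 1) + polylog_series 2 (of_real 0) + complex_of_real 0"
    by (simp only:)
  moreover have "polylog_series 2 0 = 0"
    by (simp add: polylog_series_def)
  ultimately have "c = of_real (pi ^ 2 / 6)"
    by (simp add: LIMSEQ_const_iff polylog_series_2_1)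
  then show ?thesis using c[OF assms] by simp
qed

lemma Ln_one_plus_ii: "Ln (1 + \<i>) = of_real (ln 2 / 2) + \<i> * of_real (pi / 4)"
proof (rule complex_eqI)
  have "norm (1 + \<i>) = sqrt 2" by (simp add: cmod_def)
  moreover have "1 + \<i> \<noteq> 0" by (simp add: complex_eq_iff)
  ultimately show "Re (Ln (1 + \<i>)) = Re (of_real (ln 2 / 2) + \<i> * of_real (pi / 4))"
    by (simp add: ln_sqrt)
  show "Im (Ln (1 + \<i>)) = Im (of_real (ln 2 / 2) + \<i> * of_real (pi / 4))"
    by (subst Im_Ln_eq) (auto simp: complex_eq_iff arctan_one)
qed

text \<open>Reflection at z = -i: there 1-z = 1+i lies outside the disc, while -i lies on the unit
  circle, where the series value is known.\<close>

lemma Li2_one_plus_ii: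
  "Li2 (1 + \<i>) = of_real (pi ^ 2 / 16) + \<i> * of_real (Catalan_G + pi / 4 * ln 2)"
proof -
  have "Li2 (1 + \<i>) + Li2 (- \<i>) + Ln (- \<i>) * Ln (1 + \<i>) = of_real (pi ^ 2 / 6)"
    using Li2_reflection[of "- \<i>"] by (simp add: doubly_slit_plane_iff)
  moreover have "Li2 (- \<i>) = - of_real (pi ^ 2 / 48) - \<i> * of_real Catalan_G"
    by (subst Li2_eq_polylog_series) (simp_all add: Li3_slit_plane_iff polylog_series_2_minus_ii)
  ultimately have "Li2 (1 + \<i>) = of_real (pi ^ 2 / 6) - (- of_real (pi ^ 2 / 48) - \<i> * of_real Catalan_G)
      - - (\<i> * pi / 2) * (of_real (ln 2 / 2) + \<i> * of_real (pi / 4))"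
    by (simp only: Ln_one_plus_ii Ln_minus_ii) (simp only: algebra_simps)
  then show ?thesis
    by (simp add: complex_eq_iff power2_eq_square)
qed

section \<open>The primitive K of Ln(1-z)^2 / z\<close>

text \<open>The numerator vanishes at 0, so the singularity is removable and a primitive exists on
  the star-shaped slit plane. Unlike the closed form in polylogarithms at 1-z, it is available at 0
  as well, which the integration from 0 requires.\<close>

lemma log_square_primitive:
  "\<exists>K. continuous_on Li3_slit_plane K \<and>
     (\<forall>z\<in>Li3_slit_plane - {0}. (K has_field_derivative Ln (1 - z) ^ 2 / z) (at z)) \<and>
     K 0 = 0 \<and> Im (K (1 / 2)) = 0"
proof -
  define h where "h z = Ln (1 - z) ^ 2" for z
  define g where "g = (\<lambda>z. if z = 0 then deriv h 0 else (h z - h 0) / (z - 0))"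
  have "h holomorphic_on Li3_slit_plane"
    unfolding h_def by (intro holomorphic_intros one_minus_notin_nonpos_Reals)
  then have g: "g holomorphic_on Li3_slit_plane"
    unfolding g_def by (rule pole_lemma_open[OF _ open_Li3_slit_plane])
  have "\<exists>F. \<forall>z\<in>Li3_slit_plane. (F has_field_derivative g z) (at z)"
  proof (rule holomorphic_starlike_primitive)
    show "continuous_on Li3_slit_plane g" by (rule holomorphic_on_imp_continuous_on[OF g])
    show "g field_differentiable at z" if "z \<in> Li3_slit_plane - {}" for z
      using that holomorphic_on_imp_differentiable_at[OF g] open_Li3_slit_plane by simp
  qed (simp_all add: open_Li3_slit_plane starlike_Li3_slit_plane)
  then obtain F where F: "\<And>z. z \<in> Li3_slit_plane \<Longrightarrow> (F has_field_derivative g z) (at z)"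
    by blast
  define K where "K z = F z - F 0" for z
  have K: "(K has_field_derivative g z) (at z)" if "z \<in> Li3_slit_plane" for z
    unfolding K_def using F[OF that] by (auto intro!: derivative_eq_intros)
  have K_cont: "continuous_on Li3_slit_plane K"
    using DERIV_isCont[OF K] by (intro continuous_at_imp_continuous_on) auto
  \<comment> \<open>On the real segment from 0 to 1/2 the derivative is the real number ln(1-x)^2 /
    x, so the imaginary part of K stays 0.\<close>
  have "Im (K (of_real (1 / 2))) = Im (K (of_real 0))"
  proof (rule DERIV_isconst_end[where f = "\<lambda>x. Im (K (of_real x))"])
    show "continuous_on {0..1 / 2} (\<lambda>x. Im (K (of_real x)))"
      by (intro continuous_on_Im continuous_on_compose2[OF K_cont] continuous_on_of_real continuous_on_id)
        (auto simp: Li3_slit_plane_iff)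
    fix x :: real assume x: "0 < x" "x < 1 / 2"
    have "((\<lambda>t. K (of_real t)) has_vector_derivative g (of_real x)) (at x)"
      using x by (intro has_vector_derivative_real_field K) (simp add: Li3_slit_plane_iff)
    then have "((\<lambda>t. Im (K (of_real t))) has_real_derivative Im (g (of_real x))) (at x)"
      by (rule has_field_derivative_Im)
    moreover have "g (of_real x) = of_real (ln (1 - x) ^ 2 / x)"
    proof -
      have "1 - complex_of_real x = of_real (1 - x)" by simp
      then show ?thesis
        using x Ln_of_real[of "1 - x"] by (simp add: g_def h_def del: of_real_diff)
    qed
    ultimately show "((\<lambda>t. Im (K (of_real t))) has_real_derivative 0) (at x)"
      by simp
  qed simp
  then have "Im (K (1 / 2)) = 0" by (simp add: K_def)
  moreover have "(K has_field_derivative Ln (1 - z) ^ 2 / z) (at z)" if "z \<in> Li3_slit_plane" "z \<noteq> 0" for z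
    using K[OF that(1)] that(2) by (simp add: g_def h_def)
  moreover have "K 0 = 0" by (simp add: K_def)
  ultimately show ?thesis
    using K_cont by (intro exI[of _ K]) simp
qed

text \<open>Only imaginary parts matter below, so the constant of integration (which is \<open>2 * \<zeta>(3)\<close>) just has
  to be real, and this can be read off at \<open>z = 1/2\<close>.\<close>

lemma Im_log_square_primitive_minus_ii:
  assumes deriv: "\<And>z. z \<in> Li3_slit_plane \<Longrightarrow> z \<noteq> 0 \<Longrightarrow> (K has_field_derivative Ln (1 - z) ^ 2 / z) (at z)"
    and half: "Im (K (1 / 2)) = 0"
  shows "Im (K (- \<i>)) = pi / 8 * ln 2 ^ 2 + pi ^ 3 / 16 + Catalan_G * ln 2 - 2 * Im (Li3 (1 + \<i>))"
proof -
  let ?f = "\<lambda>z. K z - (Ln z * Ln (1 - z) ^ 2 + 2 * (Ln (1 - z) * Li2 (1 - z)) - 2 * Li3 (1 - z))"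
  have "(?f has_field_derivative 0) (at z)" if z: "z \<in> doubly_slit_plane" for z
  proof -
    note D = doubly_slit_planeD[OF z]
    have L: "((\<lambda>z. Ln (1 - z)) has_field_derivative - 1 / (1 - z)) (at z)"
      using D by (auto intro!: derivative_eq_intros simp: divide_inverse)
    have L2: "((\<lambda>z. Ln (1 - z) ^ 2) has_field_derivative 2 * Ln (1 - z) * (- 1 / (1 - z))) (at z)"
      using DERIV_power[OF L, of 2] by (simp add: mult_ac)
    have L0: "(Ln has_field_derivative 1 / z) (at z)"
      using has_field_derivative_Ln[OF D(5)] by (simp add: inverse_eq_divide)
    \<comment> \<open>The product rule telescopes: the mixed term Ln z Ln(1-z)/(1-z) cancels between
      the first two products, and the Li2 term left by the second is cancelled by the derivative of
      Li3(1-z).\<close>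
    have "(?f has_field_derivative Ln (1 - z) ^ 2 / z
        - ((Ln z * (2 * Ln (1 - z) * (- 1 / (1 - z))) + 1 / z * Ln (1 - z) ^ 2)
           + 2 * (Ln (1 - z) * (Ln z / (1 - z)) + - 1 / (1 - z) * Li2 (1 - z))
           - 2 * (- Li2 (1 - z) / (1 - z)))) (at z)"
      by (intro DERIV_diff DERIV_add DERIV_mult' DERIV_cmult deriv D L L2 L0 Li2_one_minus_deriv[OF z])
    then show ?thesis by (simp add: algebra_simps)
  qed
  then obtain c where c: "\<And>z. z \<in> doubly_slit_plane \<Longrightarrow> ?f z = c"
    using constant_on_doubly_slit_plane[of ?f] by blast
  have "Im c = 0"
  proof -
    have "Li3 (of_real (1 / 2)) \<in> \<real>"
      by (subst Li3_ball) (auto intro!: polylog_series_of_real_in_Reals simp del: of_real_divide)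
    moreover have "Li2 (of_real (1 / 2)) \<in> \<real>"
      by (subst Li2_ball) (auto intro!: polylog_series_of_real_in_Reals simp del: of_real_divide)
    moreover have "Ln (of_real (1 / 2)) \<in> \<real>"
      by (subst Ln_of_real) auto
    ultimately have "Ln (1 / 2) * Ln (1 / 2) ^ 2 + 2 * (Ln (1 / 2) * Li2 (1 / 2)) - 2 * Li3 (1 / 2) \<in> \<real>"
      by (intro Reals_diff Reals_add Reals_mult Reals_power Reals_numeral) simp_all
    moreover have "?f (1 / 2) = c" by (rule c) (simp add: doubly_slit_plane_iff)
    moreover have "1 - 1 / 2 = (1 / 2 :: complex)" by simp
    ultimately show ?thesis
      using half unfolding complex_is_Real_iff by (metis diff_zero minus_complex.simps(2))
  qed
  \<comment> \<open>At z = -i every ingredient except Li3(1+i) has an explicit value.\<close>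
  moreover have "?f (- \<i>) = c" by (rule c) (simp add: doubly_slit_plane_iff)
  then have "K (- \<i>) = c + (Ln (- \<i>) * Ln (1 + \<i>) ^ 2 + 2 * (Ln (1 + \<i>) * Li2 (1 + \<i>)) - 2 * Li3 (1 + \<i>))"
    by (simp only: diff_minus_eq_add diff_eq_eq)
  ultimately have "Im (K (- \<i>)) = Im (Ln (- \<i>) * Ln (1 + \<i>) ^ 2 + 2 * (Ln (1 + \<i>) * Li2 (1 + \<i>)) - 2 * Li3 (1 + \<i>))"
    by (simp only: plus_complex.simps add_0)
  also have "\<dots> = pi / 8 * ln 2 ^ 2 + pi ^ 3 / 16 + Catalan_G * ln 2 - 2 * Im (Li3 (1 + \<i>))"
    unfolding Ln_one_plus_ii Li2_one_plus_ii Ln_minus_ii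
    by (simp add: power2_eq_square power3_eq_cube field_simps)
  finally show ?thesis .
qed

section \<open>The sum of Leibniz tails over squares\<close>

text \<open>Each step subtracts the next term (-x^2)^l of the geometric expansion of 1/(1+x^2). The
  remainder vanishes at 0 and equals the Leibniz tail at 1, which encodes the integral
  representation of that tail.\<close>

lemma arctan_tail_has_derivative:
  "((\<lambda>x. arctan x - (\<Sum>j<l. (-1) ^ j * x ^ (2 * j + 1) / (2 * real j + 1)))
     has_real_derivative (- (x ^ 2)) ^ l / (1 + x ^ 2)) (at x within S)"
proof (induction l)
  case 0
  show ?case
    using DERIV_subset[OF DERIV_arctan] by (simp add: divide_inverse)
next
  case (Suc l)
  have x: "1 + x ^ 2 \<noteq> 0" using zero_le_power2[of x] by linarith
  have "((\<lambda>x. (-1) ^ l * x ^ (2 * l + 1) / (2 * real l + 1)) has_real_derivative (-1) ^ l * x ^ (2 * l)) (at x within S)"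
    using DERIV_cdivide[OF DERIV_cmult[OF DERIV_pow[of "2 * l + 1" x S], of "(-1) ^ l"], of "2 * real l + 1"]
      nonzero_mult_div_cancel_left[of "2 * real l + 1" "(-1) ^ l * x ^ (2 * l)"]
    by (simp add: mult_ac add_ac)
  from DERIV_diff[OF Suc this] show ?case
    using x by (simp add: algebra_simps)
      (simp add: field_simps power_minus[of "x ^ 2"] flip: power_mult)
qed

text \<open>The integral is handled through antiderivatives: the termwise sum \<open>g\<close> and
  the explicit \<open>V\<close> have equal derivatives on (0,1) and both vanish at 0, so the
  required sum \<open>g 1\<close> equals \<open>V 1\<close>.\<close>

lemma leibniz_tail_over_squares_sums:
  "(\<lambda>k. leibniz_tail (k + 1) / (real k + 1) ^ 2) sums
     (pi / 4 * (ln 2) ^ 2 + 5 * pi ^ 3 / 48 + 2 * Catalan_G * ln 2 - 4 * Im (Li3 (1 + \<i>)))"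
proof -
  have pos: "0 < 1 + x ^ 2" for x :: real
    using zero_le_power2[of x] by linarith
  define f where "f k x = (arctan x - (\<Sum>j<Suc k. (-1) ^ j * x ^ (2 * j + 1) / (2 * real j + 1))) / real (Suc k) ^ 2"
    for k and x :: real
  define f' where "f' k x = (- (x ^ 2)) ^ Suc k / (1 + x ^ 2) / real (Suc k) ^ 2" for k and x :: real
  have "\<exists>g. \<forall>x\<in>{0..1}. (\<lambda>n. f n x) sums g x \<and> (g has_real_derivative (\<Sum>n. f' n x)) (at x within {0..1})"
  proof (rule has_field_derivative_series)
    show "(f n has_real_derivative f' n x) (at x within {0..1})" for n x
      unfolding f_def f'_def by (intro DERIV_cdivide arctan_tail_has_derivative)
    show "uniform_limit {0..1} (\<lambda>n x. \<Sum>i<n. f' i x) (\<lambda>x. \<Sum>n. f' n x) sequentially"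
    proof (rule Weierstrass_m_test[OF _ summable_inverse_Suc_power[OF order_refl]])
      fix n and x :: real assume x: "x \<in> {0..1}"
      have "\<bar>x\<bar> ^ (2 * Suc n) \<le> 1"
        using x by (intro power_le_one) auto
      also have "1 \<le> 1 + x ^ 2" by simp
      finally have "\<bar>x\<bar> ^ (2 * Suc n) \<le> 1 + x ^ 2" .
      moreover have "\<bar>(- (x ^ 2)) ^ Suc n\<bar> = \<bar>x\<bar> ^ (2 * Suc n)"
        by (simp only: power_abs abs_minus_cancel power_mult)
      moreover note pos
      ultimately have "\<bar>(- (x ^ 2)) ^ Suc n\<bar> / (1 + x ^ 2) \<le> 1"
        by (simp only: divide_le_eq_1_pos)
      then have "\<bar>(- (x ^ 2)) ^ Suc n\<bar> / (1 + x ^ 2) / real (Suc n) ^ 2 \<le> 1 / real (Suc n) ^ 2"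
        by (rule divide_right_mono) simp
      then show "norm (f' n x) \<le> 1 / real (Suc n) ^ 2"
        by (simp add: f'_def abs_divide del: of_nat_Suc power_Suc)
    qed
    show "summable (\<lambda>n. f n 0)" by (simp add: f_def)
  qed auto
  then obtain g where g: "\<And>x. x \<in> {0..1} \<Longrightarrow> (\<lambda>n. f n x) sums g x"
    "\<And>x. x \<in> {0..1} \<Longrightarrow> (g has_real_derivative (\<Sum>n. f' n x)) (at x within {0..1})" by blast
  have f'_sum: "(\<Sum>n. f' n x) = Re (Li2 (of_real (- (x ^ 2)))) / (1 + x ^ 2)" if x: "x \<in> {0..1}" for x
  proof -
    have nx: "norm (complex_of_real (- (x ^ 2))) \<le> 1"
      using x by (simp add: norm_power power_le_one)
    have "(\<lambda>k. Re (of_real (- (x ^ 2)) ^ Suc k / of_nat (Suc k) ^ 2)) sums Re (polylog_series 2 (of_real (- (x ^ 2))))"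
      by (intro sums_Re polylog_series_sums nx) simp
    moreover have "Re (of_real (- (x ^ 2)) ^ Suc k / of_nat (Suc k) ^ 2) = (- (x ^ 2)) ^ Suc k / real (Suc k) ^ 2" for k
    proof -
      have "complex_of_real (- (x ^ 2)) ^ Suc k / of_nat (Suc k) ^ 2 = of_real ((- (x ^ 2)) ^ Suc k / real (Suc k) ^ 2)"
        by (simp only: of_real_divide of_real_power of_real_of_nat_eq)
      then show ?thesis by (simp only: Re_complex_of_real)
    qed
    ultimately have "(\<lambda>k. (- (x ^ 2)) ^ Suc k / real (Suc k) ^ 2) sums Re (polylog_series 2 (of_real (- (x ^ 2))))"
      by (simp only:)
    from sums_divide[OF this, of "1 + x ^ 2"]
    have "(\<lambda>k. f' k x) sums (Re (polylog_series 2 (of_real (- (x ^ 2)))) / (1 + x ^ 2))"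
      unfolding f'_def by (simp only: divide_divide_eq_left mult.commute)
    moreover have "complex_of_real (- (x ^ 2)) \<in> Li3_slit_plane"
      unfolding Li3_slit_plane_iff Re_complex_of_real using zero_le_power2[of x] by linarith
    then have "Li2 (of_real (- (x ^ 2))) = polylog_series 2 (of_real (- (x ^ 2)))"
      by (rule Li2_eq_polylog_series[OF _ nx])
    ultimately show ?thesis
      by (simp only: sums_iff)
  qed
  obtain K where K: "continuous_on Li3_slit_plane K"
    "\<And>z. z \<in> Li3_slit_plane \<Longrightarrow> z \<noteq> 0 \<Longrightarrow> (K has_field_derivative Ln (1 - z) ^ 2 / z) (at z)"
    "K 0 = 0" "Im (K (1 / 2)) = 0"
    using log_square_primitive by (elim exE conjE) auto
  \<comment> \<open>Integration by parts of Li2(-x^2)/(1+x^2) leaves the integral of 2 arctan x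
    ln(1+x^2) / x, and the K summand is its antiderivative.\<close>
  define V where "V x = arctan x * Re (Li2 (of_real (- (x ^ 2)))) + 2 * Im (K (- \<i> * of_real x))" for x
  have slit: "complex_of_real (- (x ^ 2)) \<in> Li3_slit_plane" for x :: real
    unfolding Li3_slit_plane_iff Re_complex_of_real using zero_le_power2[of x] by linarith
  have slit': "- \<i> * of_real x \<in> Li3_slit_plane" for x :: real
    by (simp add: Li3_slit_plane_iff)
  have "g 1 - V 1 = g 0 - V 0"
  \<comment> \<open>The derivative formulas for \<open>Li2\<close> and \<open>K\<close> exclude the
    point 0; the endpoints are covered by continuity.\<close>
  proof (rule DERIV_isconst_end[where f = "\<lambda>x. g x - V x" and a = 0 and b = 1])
    have "continuous_on {0..1} (\<lambda>x. Li2 (of_real (- (x ^ 2))))"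
      by (rule continuous_on_compose2[OF holomorphic_on_imp_continuous_on[OF holomorphic_Li2]])
        (intro continuous_intros image_subsetI slit)+
    moreover have "continuous_on {0..1} (\<lambda>x. K (- \<i> * of_real x))"
      by (rule continuous_on_compose2[OF K(1)]) (intro continuous_intros image_subsetI slit')+
    ultimately have "continuous_on {0..1} V"
      unfolding V_def by (intro continuous_on_add continuous_on_mult continuous_on_Re continuous_on_Im
          continuous_on_const continuous_on_arctan continuous_on_id)
    moreover have "continuous_on {0..1} g"
      using g(2) by (rule DERIV_continuous_on)
    ultimately show "continuous_on {0..1} (\<lambda>x. g x - V x)"
      by (intro continuous_on_diff)
    fix x :: real assume x: "0 < x" "x < 1"
    have 1: "(g has_real_derivative Re (Li2 (of_real (- (x ^ 2)))) / (1 + x ^ 2)) (at x)"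
      using g(2)[of x] f'_sum[of x] x at_within_interior[of x "{0..1}"] by simp
    have nz: "complex_of_real (- (x ^ 2)) \<noteq> 0" "- \<i> * of_real x \<noteq> 0" using x by simp_all
    have "((\<lambda>x. complex_of_real (- (x ^ 2))) has_vector_derivative of_real (- (2 * x))) (at x)"
      by (rule has_vector_derivative_of_real) (auto intro!: derivative_eq_intros)
    from field_vector_diff_chain_at[OF this Li2_has_field_derivative[OF slit nz(1)]]
    have "((\<lambda>x. Re (Li2 (of_real (- (x ^ 2))))) has_real_derivative
        Re (of_real (- (2 * x)) * (- Ln (1 - of_real (- (x ^ 2))) / of_real (- (x ^ 2))))) (at x)"
      unfolding o_def by (rule has_field_derivative_Re)
    also have "Re (of_real (- (2 * x)) * (- Ln (1 - of_real (- (x ^ 2))) / of_real (- (x ^ 2)))) = - 2 * ln (1 + x ^ 2) / x"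
    proof -
      have "1 - complex_of_real (- (x ^ 2)) = of_real (1 + x ^ 2)" by simp
      moreover have "Ln (of_real (1 + x ^ 2)) = of_real (ln (1 + x ^ 2))"
        by (rule Ln_of_real) (rule pos)
      ultimately have "of_real (- (2 * x)) * (- Ln (1 - of_real (- (x ^ 2))) / of_real (- (x ^ 2)))
          = complex_of_real (- (2 * x) * (- ln (1 + x ^ 2) / - (x ^ 2)))"
        by (simp only: of_real_mult of_real_divide of_real_minus)
      also have "- (2 * x) * (- ln (1 + x ^ 2) / - (x ^ 2)) = - 2 * ln (1 + x ^ 2) / x"
        using x by (simp add: power2_eq_square)
      finally show ?thesis by (simp only: Re_complex_of_real)
    qed
    finally have 2: "((\<lambda>x. Re (Li2 (of_real (- (x ^ 2))))) has_real_derivative - 2 * ln (1 + x ^ 2) / x) (at x)" .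
    have "((\<lambda>x. - \<i> * of_real x) has_vector_derivative - \<i>) (at x)"
      by (auto intro!: derivative_eq_intros)
    from field_vector_diff_chain_at[OF this K(2)[OF slit' nz(2)]]
    have "((\<lambda>x. Im (K (- \<i> * of_real x))) has_real_derivative
        Im (- \<i> * (Ln (1 - - \<i> * of_real x) ^ 2 / (- \<i> * of_real x)))) (at x)"
      unfolding o_def by (rule has_field_derivative_Im)
    \<comment> \<open>Ln(1+ix) has real part ln(1+x^2)/2 and imaginary part arctan x, so the
      imaginary part of its square is their product doubled.\<close>
    also have "Im (- \<i> * (Ln (1 - - \<i> * of_real x) ^ 2 / (- \<i> * of_real x))) = ln (1 + x ^ 2) * arctan x / x"
    proof -
      have "- \<i> * (Ln (1 - - \<i> * of_real x) ^ 2 / (- \<i> * of_real x)) = Ln (1 + \<i> * of_real x) ^ 2 / of_real x"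
        using x by simp
      moreover have "1 + \<i> * of_real x \<noteq> 0" by (simp add: complex_eq_iff)
      then have "Re (Ln (1 + \<i> * of_real x)) = ln (1 + x ^ 2) / 2" "Im (Ln (1 + \<i> * of_real x)) = arctan x"
        by (simp_all add: cmod_def ln_sqrt add_pos_nonneg Im_Ln_eq)
      ultimately show ?thesis
        by (simp add: power2_eq_square)
    qed
    finally have 3: "((\<lambda>x. Im (K (- \<i> * of_real x))) has_real_derivative ln (1 + x ^ 2) * arctan x / x) (at x)" .
    have "((\<lambda>x. g x - V x) has_real_derivative
        Re (Li2 (of_real (- (x ^ 2)))) / (1 + x ^ 2)
        - ((arctan x * (- 2 * ln (1 + x ^ 2) / x) + inverse (1 + x ^ 2) * Re (Li2 (of_real (- (x ^ 2)))))
           + 2 * (ln (1 + x ^ 2) * arctan x / x))) (at x)"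
      unfolding V_def by (intro DERIV_diff DERIV_add DERIV_mult' DERIV_cmult DERIV_arctan 1 2 3)
    then show "((\<lambda>x. g x - V x) has_real_derivative 0) (at x)"
      by (simp add: divide_inverse algebra_simps)
  qed simp
  moreover have "g 0 = 0"
    using g(1)[of 0] by (simp add: f_def sums_iff)
  moreover have "V 0 = 0" by (simp add: V_def K(3))
  moreover have "V 1 = - (pi ^ 3 / 48) + 2 * (pi / 8 * ln 2 ^ 2 + pi ^ 3 / 16 + Catalan_G * ln 2 - 2 * Im (Li3 (1 + \<i>)))"
  proof -
    have "Li2 (- 1) = - of_real (pi ^ 2 / 12)"
      by (subst Li2_eq_polylog_series) (simp_all add: Li3_slit_plane_iff polylog_series_2_minus_1)
    then show ?thesis
      using Im_log_square_primitive_minus_ii[OF K(2,4)]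
      by (simp add: V_def arctan_one power2_eq_square power3_eq_cube)
  qed
  ultimately have "(\<lambda>n. f n 1) sums (- (pi ^ 3 / 48) + 2 * (pi / 8 * ln 2 ^ 2 + pi ^ 3 / 16 + Catalan_G * ln 2 - 2 * Im (Li3 (1 + \<i>))))"
    using g(1)[of 1] by simp
  moreover have "f n 1 = leibniz_tail (n + 1) / (real n + 1) ^ 2" for n
    by (simp add: f_def leibniz_tail_def arctan_one add.commute)
  ultimately show ?thesis
    by (simp add: algebra_simps)
qed

section \<open>Shifting the tails\<close>

text \<open>The alternating sum is the full sum of inverse squares minus twice its part with even
  denominators, which is a quarter of the full sum.\<close>

lemma alternating_inverse_squares_sums: "(\<lambda>k. (-1) ^ k / (real k + 1) ^ 2) sums (pi ^ 2 / 12)"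
proof -
  have sq: "(\<lambda>k. 1 / (real k + 1) ^ 2) sums (pi ^ 2 / 6)"
    using inverse_squares_sums by (simp add: add.commute)
  have "(\<lambda>k. if even k then 0 else 1 / (2 * (real ((k - 1) div 2) + 1)) ^ 2) sums (pi ^ 2 / 24)"
  proof -
    have "1 / 4 * (1 / x ^ 2) = 1 / (2 * x) ^ 2" for x :: real
      by (simp add: power_mult_distrib)
    moreover have "1 / 4 * (pi ^ 2 / 6) = pi ^ 2 / 24" by simp
    ultimately show ?thesis
      using sums_if'[OF sums_mult[OF sq, of "1/4"]] by (simp only:)
  qed
  from sums_diff[OF sq sums_mult[OF this, of 2]]
  have "(\<lambda>k. 1 / (real k + 1)\<^sup>2 - 2 * (if even k then 0 else 1 / (2 * (real ((k - 1) div 2) + 1))\<^sup>2))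
      sums (pi ^ 2 / 12)" by simp
  moreover have "1 / (real k + 1)\<^sup>2 - 2 * (if even k then 0 else 1 / (2 * (real ((k - 1) div 2) + 1))\<^sup>2)
      = (-1) ^ k / (real k + 1) ^ 2" for k
    by (auto elim!: oddE simp: add.commute)
  ultimately show ?thesis by (simp only:)
qed

text \<open>With c = 2e+1 and x = k+1, 1/((2x+c) x^2) = 1/(c x^2) - 2/(c^2 x) + 4/(c^2 (2x+c)). The
  three alternating sums give pi^2/12, ln 2 and the Leibniz tail from index e+1, because 2x+c =
  2(k+e+1)+1.\<close>

lemma alternating_partial_fractions_sums:
  "(\<lambda>k. (-1) ^ (k + 1) / ((2 * (real k + 1) + 2 * real e + 1) * (real k + 1) ^ 2)) sums
     (- (pi ^ 2 / 12) / (2 * real e + 1) + 2 * ln 2 / (2 * real e + 1) ^ 2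
      + 4 * (-1) ^ e * leibniz_tail (e + 1) / (2 * real e + 1) ^ 2)"
proof -
  define c where "c = 2 * real e + 1"
  have c: "c > 0" by (simp add: c_def)
  have 1: "(\<lambda>k. (-1) ^ k / (real k + 1)) sums ln 2"
    using alternating_harmonic_series_sums by (simp add: add.commute)
  have 3: "(\<lambda>k. (-1) ^ k / (2 * real (k + (e + 1)) + 1)) sums ((-1) ^ (e + 1) * leibniz_tail (e + 1))"
    by (rule leibniz_tail_sums)
  have "(\<lambda>k. - (1 / c) * ((-1) ^ k / (real k + 1) ^ 2) + 2 / c ^ 2 * ((-1) ^ k / (real k + 1))
           - 4 / c ^ 2 * ((-1) ^ k / (2 * real (k + (e + 1)) + 1))) sums
      (- (1 / c) * (pi ^ 2 / 12) + 2 / c ^ 2 * ln 2 - 4 / c ^ 2 * ((-1) ^ (e + 1) * leibniz_tail (e + 1)))"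
    by (intro sums_add sums_diff sums_mult 1 3 alternating_inverse_squares_sums)
  also have "(\<lambda>k. - (1 / c) * ((-1) ^ k / (real k + 1) ^ 2) + 2 / c ^ 2 * ((-1) ^ k / (real k + 1))
           - 4 / c ^ 2 * ((-1) ^ k / (2 * real (k + (e + 1)) + 1)))
      = (\<lambda>k. (-1) ^ (k + 1) / ((2 * (real k + 1) + 2 * real e + 1) * (real k + 1) ^ 2))"
  proof
    fix k
    define x where "x = real k + 1"
    have x: "x > 0" by (simp add: x_def)
    have "- (1 / c) * (1 / x ^ 2) + 2 / c ^ 2 * (1 / x) - 4 / c ^ 2 * (1 / (2 * x + c))
        = - 1 / ((2 * x + c) * x ^ 2)"
      using c x add_pos_pos[of "2 * x" c] by (simp add: divide_simps power2_eq_square) (simp add: algebra_simps)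
    from arg_cong[OF this, of "\<lambda>t. (-1) ^ k * t"]
    show "- (1 / c) * ((-1) ^ k / (real k + 1) ^ 2) + 2 / c ^ 2 * ((-1) ^ k / (real k + 1))
           - 4 / c ^ 2 * ((-1) ^ k / (2 * real (k + (e + 1)) + 1))
      = (-1) ^ (k + 1) / ((2 * (real k + 1) + 2 * real e + 1) * (real k + 1) ^ 2)"
      by (simp add: x_def c_def algebra_simps)
  qed
  finally show ?thesis by (simp add: c_def mult.assoc)
qed

text \<open>With \<open>B = \<Sum>k. R (k+1) / (k+1)\<^sup>2\<close>, this is \<open>\<Sum>k. R (k+1+e) / (k+1)\<^sup>2\<close>.\<close>

fun shifted_tail_sum :: "real \<Rightarrow> nat \<Rightarrow> real" where
  "shifted_tail_sum B 0 = B"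
| "shifted_tail_sum B (Suc e) = shifted_tail_sum B e
     - ((-1) ^ e * (- (pi ^ 2 / 12) / (2 * real e + 1) + 2 * ln 2 / (2 * real e + 1) ^ 2)
        + 4 * leibniz_tail (e + 1) / (2 * real e + 1) ^ 2)"

text \<open>Consecutive tails differ by a single Leibniz term; divided by (k+1)^2 and summed over k,
  these differences are (-1)^e times the preceding series.\<close>

lemma shifted_tail_sum_sums:
  assumes "(\<lambda>k. leibniz_tail (k + 1) / (real k + 1) ^ 2) sums B"
  shows "(\<lambda>k. leibniz_tail (k + 1 + e) / (real k + 1) ^ 2) sums shifted_tail_sum B e"
proof (induction e)
  case 0
  then show ?case using assms by simp
next
  case (Suc e)
  let ?c = "2 * real e + 1"
  have "(\<lambda>k. (-1) ^ e * ((-1) ^ (k + 1) / ((2 * (real k + 1) + 2 * real e + 1) * (real k + 1) ^ 2))) sums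
     ((-1) ^ e * (- (pi ^ 2 / 12) / ?c + 2 * ln 2 / ?c ^ 2 + 4 * (-1) ^ e * leibniz_tail (e + 1) / ?c ^ 2))"
    by (intro sums_mult alternating_partial_fractions_sums)
  from sums_diff[OF Suc this]
  have "(\<lambda>k. leibniz_tail (k + 1 + e) / (real k + 1)\<^sup>2
        - (-1) ^ e * ((-1) ^ (k + 1) / ((2 * (real k + 1) + 2 * real e + 1) * (real k + 1)\<^sup>2))) sums
      (shifted_tail_sum B e
        - (-1) ^ e * (- (pi ^ 2 / 12) / ?c + 2 * ln 2 / ?c ^ 2 + 4 * (-1) ^ e * leibniz_tail (e + 1) / ?c ^ 2))" .
  moreover have "leibniz_tail (k + 1 + e) / (real k + 1)\<^sup>2
        - (-1) ^ e * ((-1) ^ (k + 1) / ((2 * (real k + 1) + 2 * real e + 1) * (real k + 1)\<^sup>2))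
      = leibniz_tail (k + 1 + Suc e) / (real k + 1)\<^sup>2" for k
  proof -
    define d where "d = 2 * real (k + 1 + e) + 1"
    have "leibniz_tail (k + 1 + Suc e) = leibniz_tail (k + 1 + e) - (-1) ^ (k + 1 + e) / d"
      using leibniz_tail_Suc[of "k + 1 + e"] by (simp add: d_def)
    moreover have "2 * (real k + 1) + 2 * real e + 1 = d" by (simp add: d_def)
    ultimately show ?thesis by (simp add: power_add add_divide_distrib mult.commute)
  qed
  moreover have "shifted_tail_sum B e
        - (-1) ^ e * (- (pi ^ 2 / 12) / ?c + 2 * ln 2 / ?c ^ 2 + 4 * (-1) ^ e * leibniz_tail (e + 1) / ?c ^ 2)
      = shifted_tail_sum B (Suc e)"
    by (cases "even e") simp_all
  ultimately show ?case by (simp only:)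
qed

section \<open>Closed forms of the shifted sums for either parity\<close>

text \<open>The bracket of case (iv) for n-m = 2p without the sums over k up to m. \<open>B\<close>
  gathers the transcendental constants free of p, and p = 0 gives case (i).\<close>

definition even_closed_form :: "real \<Rightarrow> nat \<Rightarrow> real" where
  "even_closed_form B p =
     - 4
     - 4 * (\<Sum>j<p. 1 / (4 * real j + 5) ^ 3)
     - 8 * (\<Sum>k<p. \<Sum>j=0..2 * k + 1.
              (-1) ^ j * (16 * real k ^ 2 + 32 * real k + 17)
                / ((2 * real j + 1) * (4 * real k + 5) ^ 2 * (4 * real k + 3) ^ 2))
     + (1 + (\<Sum>j<p. 2 * (16 * real j ^ 2 + 32 * real j + 17)
                   / ((4 * real j + 5) ^ 2 * (4 * real j + 3) ^ 2))) * pi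
     + (1 - 16 * (\<Sum>j<p. (real j + 1) / ((4 * real j + 5) ^ 2 * (4 * real j + 3) ^ 2))) * 2 * ln 2
     + (- (1 / 2) + (\<Sum>j<p. 1 / ((4 * real j + 5) * (4 * real j + 3)))) * (pi ^ 2 / 6)
     - B"

text \<open>The counterpart for n-m = 2p+1, covering case (iii), and case (ii) at p = 0.\<close>

definition odd_closed_form :: "real \<Rightarrow> nat \<Rightarrow> real" where
  "odd_closed_form B p =
     116 / 27
     - 4 * (\<Sum>j=1..p. 1 / (4 * real j + 3) ^ 3)
     + 8 * (\<Sum>k=1..p. \<Sum>j=0..2 * k.
              (-1) ^ j * (16 * real k ^ 2 + 16 * real k + 5)
                / ((2 * real j + 1) * (4 * real k + 3) ^ 2 * (4 * real k + 1) ^ 2))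
     + (- (10 / 9) - (\<Sum>j=1..p. 2 * (16 * real j ^ 2 + 16 * real j + 5)
                   / ((4 * real j + 3) ^ 2 * (4 * real j + 1) ^ 2))) * pi
     - (1 / 9 + (\<Sum>j=1..p. (2 * real j + 1) / ((4 * real j + 3) ^ 2 * (4 * real j + 1) ^ 2))) * 16 * ln 2
     + (1 / 18 + 1 / 6 * (\<Sum>j=1..p. 1 / ((4 * real j + 3) * (4 * real j + 1)))) * pi ^ 2
     + B"

text \<open>The left side is the increment of the closed form from p to p+1 and the right side is
  minus that of two steps of the recursion. \<open>P\<close>, \<open>L\<close>, \<open>E\<close>,
  \<open>T\<close> stand for pi, ln 2, pi^2 and a Leibniz partial sum.\<close>

lemma even_step_algebra:
  fixes x P L T E :: real
  assumes x: "x \<ge> 0"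
  shows "- 4 * (1 / (4 * x + 5) ^ 3)
      - 8 * (T * ((16 * x ^ 2 + 32 * x + 17) / ((4 * x + 5) ^ 2 * (4 * x + 3) ^ 2)))
      + 2 * (16 * x ^ 2 + 32 * x + 17) / ((4 * x + 5) ^ 2 * (4 * x + 3) ^ 2) * P
      - 16 * ((x + 1) / ((4 * x + 5) ^ 2 * (4 * x + 3) ^ 2)) * 2 * L
      + 1 / ((4 * x + 5) * (4 * x + 3)) * (E / 6)
    = E / 12 / (4 * x + 3) - 2 * L / (4 * x + 3) ^ 2 + 4 * (P / 4 - T) / (4 * x + 3) ^ 2
      + (- (E / 12) / (4 * x + 5) + 2 * L / (4 * x + 5) ^ 2
         + 4 * (P / 4 - T - 1 / (4 * x + 5)) / (4 * x + 5) ^ 2)"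
proof -
  define a b where "a = 4 * x + 5" and "b = 4 * x + 3"
  have ab: "a > 0" "b > 0" using x by (simp_all add: a_def b_def)
  \<comment> \<open>Since a-b = 2, a^2-b^2 = 16(x+1) and a^2+b^2 = 2(16x^2+32x+17), every
    coefficient becomes a polynomial in 1/a and 1/b.\<close>
  define u v where "u = 1 / a" and "v = 1 / b"
  have 1: "y * (16 * x ^ 2 + 32 * x + 17) / (a ^ 2 * b ^ 2) = y * (u ^ 2 + v ^ 2) / 2" for y
    using ab unfolding u_def v_def by (simp add: divide_simps) (simp add: a_def b_def power2_eq_square algebra_simps)
  have 2: "(x + 1) / (a ^ 2 * b ^ 2) = (v ^ 2 - u ^ 2) / 16"
    using ab unfolding u_def v_def by (simp add: divide_simps) (simp add: a_def b_def power2_eq_square algebra_simps)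
  have 3: "1 / (a * b) = (v - u) / 2"
    using ab unfolding u_def v_def by (simp add: divide_simps) (simp add: a_def b_def)
  have 4: "y / a ^ 3 = y * u ^ 3" "y / a ^ 2 = y * u ^ 2" "y / b ^ 2 = y * v ^ 2"
    "y / a = y * u" "y / b = y * v" for y
    by (simp_all add: u_def v_def power_divide)
  show ?thesis
    unfolding a_def[symmetric] b_def[symmetric] 1[of 1, simplified mult_1_left] 1 2 3 4
    by (simp add: field_simps power2_eq_square power3_eq_cube)
qed

text \<open>The same comparison for odd n-m; now a^2-b^2 = 8(2x+1) and a^2+b^2 =
  2(16x^2+16x+5).\<close>

lemma odd_step_algebra:
  fixes x P L T E :: real
  assumes x: "x \<ge> 0"
  shows "- 4 * (1 / (4 * x + 3) ^ 3)
      + 8 * (T * ((16 * x ^ 2 + 16 * x + 5) / ((4 * x + 3) ^ 2 * (4 * x + 1) ^ 2)))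
      - 2 * (16 * x ^ 2 + 16 * x + 5) / ((4 * x + 3) ^ 2 * (4 * x + 1) ^ 2) * P
      - (2 * x + 1) / ((4 * x + 3) ^ 2 * (4 * x + 1) ^ 2) * 16 * L
      + 1 / 6 * (1 / ((4 * x + 3) * (4 * x + 1))) * E
    = - (- (E / 12) / (4 * x + 1) + 2 * L / (4 * x + 1) ^ 2 + 4 * (P / 4 - T) / (4 * x + 1) ^ 2)
      - ((E / 12) / (4 * x + 3) - 2 * L / (4 * x + 3) ^ 2
         + 4 * (P / 4 - T + 1 / (4 * x + 3)) / (4 * x + 3) ^ 2)"
proof -
  define a b where "a = 4 * x + 3" and "b = 4 * x + 1"
  have ab: "a > 0" "b > 0" using x by (simp_all add: a_def b_def)
  define u v where "u = 1 / a" and "v = 1 / b"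
  have 1: "y * (16 * x ^ 2 + 16 * x + 5) / (a ^ 2 * b ^ 2) = y * (u ^ 2 + v ^ 2) / 2" for y
    using ab unfolding u_def v_def by (simp add: divide_simps) (simp add: a_def b_def power2_eq_square algebra_simps)
  have 2: "(2 * x + 1) / (a ^ 2 * b ^ 2) = (v ^ 2 - u ^ 2) / 8"
    using ab unfolding u_def v_def by (simp add: divide_simps) (simp add: a_def b_def power2_eq_square algebra_simps)
  have 3: "1 / (a * b) = (v - u) / 2"
    using ab unfolding u_def v_def by (simp add: divide_simps) (simp add: a_def b_def)
  have 4: "y / a ^ 3 = y * u ^ 3" "y / a ^ 2 = y * u ^ 2" "y / b ^ 2 = y * v ^ 2"
    "y / a = y * u" "y / b = y * v" for y
    by (simp_all add: u_def v_def power_divide)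
  show ?thesis
    unfolding a_def[symmetric] b_def[symmetric] 1[of 1, simplified mult_1_left] 1 2 3 4
    by (simp add: field_simps power2_eq_square power3_eq_cube)
qed

text \<open>The shift is d+1 with d = 2p, so raising p by one takes two steps of the recursion; the
  base case is its first step.\<close>

lemma even_closed_form_eq: "- shifted_tail_sum B (2 * p + 1) = even_closed_form B p"
proof (induction p)
  case 0
  show ?case by (simp add: even_closed_form_def leibniz_tail_def)
next
  case (Suc p)
  define T where "T = (\<Sum>j<2 * p + 2. (-1) ^ j / (2 * real j + 1))"
  have T: "(\<Sum>j=0..2 * p + 1. (-1) ^ j * N / ((2 * real j + 1) * a * b)) = T * (N / (a * b))" for N a b
    unfolding T_def sum_distrib_right
    by (rule sum.cong) (auto simp: mult.assoc)
  have R1: "leibniz_tail (2 * p + 2) = pi / 4 - T"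
    by (simp only: leibniz_tail_def T_def)
  have R2: "leibniz_tail (2 * p + 3) = pi / 4 - T - 1 / (4 * real p + 5)"
  proof -
    have "leibniz_tail (Suc (2 * p + 2)) = pi / 4 - T - (-1) ^ (2 * p + 2) / (2 * real (2 * p + 2) + 1)"
      by (simp only: leibniz_tail_Suc R1)
    moreover have "Suc (2 * p + 2) = 2 * p + 3" "2 * real (2 * p + 2) + 1 = 4 * real p + 5"
      "(-1) ^ (2 * p + 2) = (1 :: real)"
      by simp_all
    ultimately show ?thesis by (simp only:)
  qed
  \<comment> \<open>Splits off the last summand of all five sums at once, leaving the increment in
    the shape of \<open>even_step_algebra\<close>.\<close>
  have alg: "- 4 - 4 * (s1 + d1) - 8 * (s2 + d2) + (1 + (s3 + d3)) * P + (1 - 16 * (s4 + d4)) * 2 * L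
       + (- (1 / 2) + (s5 + d5)) * (E / 6) - B
     = (- 4 - 4 * s1 - 8 * s2 + (1 + s3) * P + (1 - 16 * s4) * 2 * L + (- (1 / 2) + s5) * (E / 6) - B)
       + (- 4 * d1 - 8 * d2 + d3 * P - 16 * d4 * 2 * L + d5 * (E / 6))"
    for s1 s2 s3 s4 s5 d1 d2 d3 d4 d5 P L E :: real
    by (simp add: algebra_simps)
  have "even_closed_form B (Suc p) = even_closed_form B p
      + (pi ^ 2 / 12 / (4 * real p + 3) - 2 * ln 2 / (4 * real p + 3) ^ 2 + 4 * (pi / 4 - T) / (4 * real p + 3) ^ 2
         + (- (pi ^ 2 / 12) / (4 * real p + 5) + 2 * ln 2 / (4 * real p + 5) ^ 2
            + 4 * (pi / 4 - T - 1 / (4 * real p + 5)) / (4 * real p + 5) ^ 2))"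
    unfolding even_closed_form_def sum.lessThan_Suc alg T
    by (subst even_step_algebra) simp_all
  moreover have "shifted_tail_sum B (2 * Suc p + 1) = shifted_tail_sum B (2 * p + 1)
      - (pi ^ 2 / 12 / (4 * real p + 3) - 2 * ln 2 / (4 * real p + 3) ^ 2 + 4 * (pi / 4 - T) / (4 * real p + 3) ^ 2)
      - (- (pi ^ 2 / 12) / (4 * real p + 5) + 2 * ln 2 / (4 * real p + 5) ^ 2
         + 4 * (pi / 4 - T - 1 / (4 * real p + 5)) / (4 * real p + 5) ^ 2)"
  proof -
    have "2 * Suc p + 1 = Suc (Suc (2 * p + 1))" by simp
    moreover have "2 * real (2 * p + 1) + 1 = 4 * real p + 3" "2 * real (Suc (2 * p + 1)) + 1 = 4 * real p + 5"
      "2 * p + 1 + 1 = 2 * p + 2" "Suc (2 * p + 1) + 1 = 2 * p + 3"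
      "(-1) ^ (2 * p + 1) = (-1 :: real)" "(-1) ^ Suc (2 * p + 1) = (1 :: real)"
      by simp_all
    ultimately show ?thesis
      by (simp only: shifted_tail_sum.simps R1 R2) (simp only: mult_minus1 mult_1_left minus_add minus_minus minus_divide_left diff_conv_add_uminus add.assoc)
  qed
  ultimately show ?case using Suc by linarith
qed

text \<open>Here the shift is d+1 with d = 2p+1. The base case performs the first two steps of the
  recursion, which is where 116/27, 10/9 and 1/18 come from.\<close>

lemma odd_closed_form_eq: "shifted_tail_sum B (2 * p + 2) = odd_closed_form B p"
proof (induction p)
  case 0
  show ?case by (simp add: odd_closed_form_def leibniz_tail_def eval_nat_numeral field_simps)
next
  case (Suc p)
  \<comment> \<open>The sums of the odd form start at 1, so the new summand has index p+1.\<close>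
  define x where "x = real (Suc p)"
  define T where "T = (\<Sum>j<2 * p + 3. (-1) ^ j / (2 * real j + 1))"
  have T: "(\<Sum>j=0..2 * Suc p. (-1) ^ j * N / ((2 * real j + 1) * a * b)) = T * (N / (a * b))" for N a b
    unfolding T_def sum_distrib_right
    by (rule sum.cong) (auto simp: mult.assoc)
  have R1: "leibniz_tail (2 * p + 3) = pi / 4 - T"
    by (simp only: leibniz_tail_def T_def)
  have R2: "leibniz_tail (2 * p + 4) = pi / 4 - T + 1 / (4 * x + 3)"
  proof -
    have "leibniz_tail (Suc (2 * p + 3)) = pi / 4 - T - (-1) ^ (2 * p + 3) / (2 * real (2 * p + 3) + 1)"
      by (simp only: leibniz_tail_Suc R1)
    moreover have "Suc (2 * p + 3) = 2 * p + 4" "2 * real (2 * p + 3) + 1 = 4 * x + 3"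
      "(-1) ^ (2 * p + 3) = (-1 :: real)"
      by (simp_all add: x_def power_add)
    ultimately show ?thesis by simp
  qed
  have alg: "116 / 27 - 4 * (s1 + d1) + 8 * (s2 + d2) + (- (10 / 9) - (s3 + d3)) * P - (1 / 9 + (s4 + d4)) * 16 * L
       + (1 / 18 + 1 / 6 * (s5 + d5)) * E + B
     = (116 / 27 - 4 * s1 + 8 * s2 + (- (10 / 9) - s3) * P - (1 / 9 + s4) * 16 * L + (1 / 18 + 1 / 6 * s5) * E + B)
       + (- 4 * d1 + 8 * d2 - d3 * P - d4 * 16 * L + 1 / 6 * d5 * E)"
    for s1 s2 s3 s4 s5 d1 d2 d3 d4 d5 P L E :: real
    by (simp add: algebra_simps)
  have split: "(\<Sum>j=1..Suc p. f j) = (\<Sum>j=1..p. f j) + f (Suc p)" for f :: "nat \<Rightarrow> real"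
    by simp
  have "odd_closed_form B (Suc p) = odd_closed_form B p
      + (- (- (pi ^ 2 / 12) / (4 * x + 1) + 2 * ln 2 / (4 * x + 1) ^ 2 + 4 * (pi / 4 - T) / (4 * x + 1) ^ 2)
         - ((pi ^ 2 / 12) / (4 * x + 3) - 2 * ln 2 / (4 * x + 3) ^ 2
            + 4 * (pi / 4 - T + 1 / (4 * x + 3)) / (4 * x + 3) ^ 2))"
    unfolding odd_closed_form_def split alg T x_def
    by (subst odd_step_algebra[symmetric]) simp_all
  moreover have "shifted_tail_sum B (2 * Suc p + 2) = shifted_tail_sum B (2 * p + 2)
      - (- (pi ^ 2 / 12) / (4 * x + 1) + 2 * ln 2 / (4 * x + 1) ^ 2 + 4 * (pi / 4 - T) / (4 * x + 1) ^ 2)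
      - ((pi ^ 2 / 12) / (4 * x + 3) - 2 * ln 2 / (4 * x + 3) ^ 2
         + 4 * (pi / 4 - T + 1 / (4 * x + 3)) / (4 * x + 3) ^ 2)"
  proof -
    have "2 * Suc p + 2 = Suc (Suc (2 * p + 2))" by simp
    moreover have "2 * real (2 * p + 2) + 1 = 4 * x + 1" "2 * real (Suc (2 * p + 2)) + 1 = 4 * x + 3"
      "2 * p + 2 + 1 = 2 * p + 3" "Suc (2 * p + 2) + 1 = 2 * p + 4"
      "(-1) ^ (2 * p + 2) = (1 :: real)" "(-1) ^ Suc (2 * p + 2) = (-1 :: real)"
      by (simp_all add: x_def)
    ultimately show ?thesis
      by (simp only: shifted_tail_sum.simps R1 R2) (simp only: mult_minus1 mult_1_left minus_add minus_minus minus_divide_left diff_conv_add_uminus add.assoc)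
  qed
  ultimately show ?case using Suc by linarith
qed

section \<open>Assembly of the four cases\<close>

text \<open>Up to sign the series is the shifted sum without its first m terms. In each removed term
  the tail splits into pi/4 and a finite Leibniz sum, which yields the two sums over k.\<close>

lemma Theta2_sums:
  assumes "(\<lambda>k. leibniz_tail (k + 1) / (real k + 1) ^ 2) sums B"
  shows "(\<lambda>k. Theta2_term m (m + d) (Suc k)) sums
    ((-1) ^ m * ((-1) ^ d * (- shifted_tail_sum B (d + 1) + pi * (\<Sum>k=1..m. 1 / (4 * real k ^ 2))
       - (\<Sum>k=1..m. \<Sum>j=0..k + d. (-1) ^ j / (real k ^ 2 * (2 * real j + 1))))))"
proof -
  let ?t = "\<lambda>k. leibniz_tail (k + 1 + (d + 1)) / (real k + 1) ^ 2"
  have "(\<lambda>k. (-1) ^ Suc (m + d) * ?t (k + m)) sums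
     ((-1) ^ Suc (m + d) * (shifted_tail_sum B (d + 1) - (\<Sum>k<m. ?t k)))"
    by (intro sums_mult sums_split_initial_segment shifted_tail_sum_sums[OF assms])
  moreover have "(-1) ^ Suc (m + d) * ?t (k + m) = Theta2_term m (m + d) (Suc k)" for k
    unfolding Theta2_term_eq by (simp add: ac_simps)
  moreover have "(\<Sum>k<m. ?t k) = pi * (\<Sum>k=1..m. 1 / (4 * real k ^ 2))
       - (\<Sum>k=1..m. \<Sum>j=0..k + d. (-1) ^ j / (real k ^ 2 * (2 * real j + 1)))"
  proof -
    have "(\<Sum>k<m. ?t k) = (\<Sum>k=1..m. leibniz_tail (k + d + 1) / real k ^ 2)"
      by (rule sum.reindex_bij_witness[where i = "\<lambda>k. k - 1" and j = Suc]) (auto simp: add.commute)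
    also have "\<dots> = (\<Sum>k=1..m. pi * (1 / (4 * real k ^ 2))
        - (\<Sum>j=0..k + d. (-1) ^ j / (real k ^ 2 * (2 * real j + 1))))"
    proof (rule sum.cong)
      fix k
      have "{..<k + d + 1} = {0..k + d}" by auto
      then show "leibniz_tail (k + d + 1) / real k ^ 2
          = pi * (1 / (4 * real k ^ 2)) - (\<Sum>j=0..k + d. (-1) ^ j / (real k ^ 2 * (2 * real j + 1)))"
        unfolding leibniz_tail_def by (simp add: diff_divide_distrib sum_divide_distrib mult.commute)
    qed simp
    finally show ?thesis by (simp add: sum_subtractf sum_distrib_left)
  qed
  moreover have "(-1) ^ Suc (m + d) * (x - y) = (-1) ^ m * ((-1) ^ d * (- x + y))" for x y :: real
    by (simp add: power_add algebra_simps)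
  ultimately show ?thesis by (simp only: add_diff_eq)
qed

theorem theorem9:
  fixes m n :: nat
  assumes "m \<ge> 1" and "n \<ge> m"
  shows
   "(n = m \<longrightarrow>
      (\<lambda>k. Theta2_term m n (Suc k)) sums
      ((-1) ^ m *
        (- 4
         - (\<Sum>k=1..m. \<Sum>j=0..k. (-1) ^ j / (real k ^ 2 * (2 * real j + 1)))
         + (1 + (\<Sum>k=1..m. 1 / (4 * real k ^ 2))) * pi
         + 2 * ln 2 - pi / 4 * (ln 2) ^ 2 - pi ^ 2 / 12 - 5 * pi ^ 3 / 48
         - 2 * Catalan_G * ln 2 + 4 * Im (Li3 (1 + \<i>)))))
    \<and>
    (n = m + 1 \<longrightarrow>
      (\<lambda>k. Theta2_term m n (Suc k)) sums
      ((-1) ^ m *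
        (116 / 27
         + (\<Sum>k=1..m. \<Sum>j=0..k+1. (-1) ^ j / (real k ^ 2 * (2 * real j + 1)))
         - (10 / 9 + (\<Sum>k=1..m. 1 / (4 * real k ^ 2))) * pi
         - 16 * ln 2 / 9 + pi / 4 * (ln 2) ^ 2 + pi ^ 2 / 18 + 5 * pi ^ 3 / 48
         + 2 * Catalan_G * ln 2 - 4 * Im (Li3 (1 + \<i>)))))
    \<and>
    (odd (n - m) \<and> n - m \<noteq> 1 \<longrightarrow>
      (\<lambda>k. Theta2_term m n (Suc k)) sums
      ((-1) ^ m *
        (116 / 27
         - 4 * (\<Sum>j=1..(n - m - 1) div 2. 1 / (4 * real j + 3) ^ 3)
         - (\<Sum>k=1..m. \<Sum>j=0..k + (n - m).
              (-1) ^ (j + (n - m)) / (real k ^ 2 * (2 * real j + 1)))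
         + 8 * (\<Sum>k=1..(n - m - 1) div 2. \<Sum>j=0..2 * k.
              (-1) ^ j * (16 * real k ^ 2 + 16 * real k + 5)
                / ((2 * real j + 1) * (4 * real k + 3) ^ 2 * (4 * real k + 1) ^ 2))
         + (- (10 / 9)
            - (\<Sum>j=1..(n - m - 1) div 2.
                 2 * (16 * real j ^ 2 + 16 * real j + 5)
                   / ((4 * real j + 3) ^ 2 * (4 * real j + 1) ^ 2))
            + 1 / 4 * (ln 2) ^ 2
            + (\<Sum>k=1..m. (-1) ^ (n - m) / (4 * real k ^ 2))) * pi
         - (1 / 9
            + (\<Sum>j=1..(n - m - 1) div 2.
                 (2 * real j + 1) / ((4 * real j + 3) ^ 2 * (4 * real j + 1) ^ 2))) * 16 * ln 2
         + (1 / 18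
            + 1 / 6 * (\<Sum>j=1..(n - m - 1) div 2.
                 1 / ((4 * real j + 3) * (4 * real j + 1)))) * pi ^ 2
         + 5 * pi ^ 3 / 48 + 2 * Catalan_G * ln 2 - 4 * Im (Li3 (1 + \<i>)))))
    \<and>
    (even (n - m) \<longrightarrow>
      (\<lambda>k. Theta2_term m n (Suc k)) sums
      ((-1) ^ m *
        (- 4
         - 4 * (\<Sum>j<(n - m) div 2. 1 / (4 * real j + 5) ^ 3)
         - (\<Sum>k=1..m. \<Sum>j=0..k + (n - m).
              (-1) ^ (j + (n - m)) / (real k ^ 2 * (2 * real j + 1)))
         - 8 * (\<Sum>k<(n - m) div 2. \<Sum>j=0..2 * k + 1.
              (-1) ^ j * (16 * real k ^ 2 + 32 * real k + 17)
                / ((2 * real j + 1) * (4 * real k + 5) ^ 2 * (4 * real k + 3) ^ 2))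
         + (1
            + (\<Sum>j<(n - m) div 2.
                 2 * (16 * real j ^ 2 + 32 * real j + 17)
                   / ((4 * real j + 5) ^ 2 * (4 * real j + 3) ^ 2))
            - 1 / 4 * (ln 2) ^ 2
            + (\<Sum>k=1..m. (-1) ^ (n - m) / (4 * real k ^ 2))) * pi
         + (1 - 16 * (\<Sum>j<(n - m) div 2.
                 (real j + 1) / ((4 * real j + 5) ^ 2 * (4 * real j + 3) ^ 2))) * 2 * ln 2
         + (- (1 / 2)
            + (\<Sum>j<(n - m) div 2. 1 / ((4 * real j + 5) * (4 * real j + 3)))) * (pi ^ 2 / 6)
         - 5 * pi ^ 3 / 48 - 2 * Catalan_G * ln 2 + 4 * Im (Li3 (1 + \<i>)))))"
proof -
  define B where
    "B = pi / 4 * (ln 2) ^ 2 + 5 * pi ^ 3 / 48 + 2 * Catalan_G * ln 2 - 4 * Im (Li3 (1 + \<i>))"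
  have B: "(\<lambda>k. leibniz_tail (k + 1) / (real k + 1) ^ 2) sums B"
    unfolding B_def by (rule leibniz_tail_over_squares_sums)
  obtain d where n: "n = m + d" using assms(2) le_Suc_ex by blast
  let ?H = "\<Sum>k=1..m. 1 / (4 * real k ^ 2)"
  let ?F = "\<Sum>k=1..m. \<Sum>j=0..k + d. (-1) ^ j / (real k ^ 2 * (2 * real j + 1))"
  have evenI: "(\<lambda>k. Theta2_term m n (Suc k)) sums v"
    if "even d" "v = (-1) ^ m * (even_closed_form B (d div 2) + pi * ?H - ?F)" for v
  proof -
    have "- shifted_tail_sum B (d + 1) = even_closed_form B (d div 2)"
      using even_closed_form_eq[of B "d div 2"] that(1) by simp
    then show ?thesis using Theta2_sums[OF B, of m d] that n by simp
  qed
  have oddI: "(\<lambda>k. Theta2_term m n (Suc k)) sums v"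
    if "odd d" "v = (-1) ^ m * (odd_closed_form B ((d - 1) div 2) - pi * ?H + ?F)" for v
  proof -
    have "2 * ((d - 1) div 2) + 2 = d + 1" using that(1) by (auto elim!: oddE)
    then have "shifted_tail_sum B (d + 1) = odd_closed_form B ((d - 1) div 2)"
      using odd_closed_form_eq[of B "(d - 1) div 2"] by simp
    then have "(-1) ^ d * (- shifted_tail_sum B (d + 1) + pi * ?H - ?F) = odd_closed_form B ((d - 1) div 2) - pi * ?H + ?F"
      using that(1) by simp
    then show ?thesis using Theta2_sums[OF B, of m d] unfolding n that(2) by (simp only:)
  qed
  have F_even: "(\<Sum>k=1..m. \<Sum>j=0..k + d. (-1) ^ (j + d) / (real k ^ 2 * (2 * real j + 1))) = ?F" if "even d"
    using that by (simp add: power_add)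
  have F_odd: "(\<Sum>k=1..m. \<Sum>j=0..k + d. (-1) ^ (j + d) / (real k ^ 2 * (2 * real j + 1))) = - ?F" if "odd d"
    using that by (simp add: power_add sum_negf)
  have H_odd: "(\<Sum>k=1..m. (-1) ^ d / (4 * real k ^ 2)) = - ?H" if "odd d"
    using that by (simp add: sum_negf)
  have H_even: "(\<Sum>k=1..m. (-1) ^ d / (4 * real k ^ 2)) = ?H" if "even d"
    using that by simp
  show ?thesis
  proof (intro conjI impI, goal_cases)
    case 1
    then have "d = 0" using n by simp
    then show ?case
      by (intro evenI) (simp_all add: even_closed_form_def B_def algebra_simps)
  next
    case 2
    then have "d = 1" using n by simp
    show ?case
      by (rule oddI) (simp_all only: \<open>d = 1\<close>, simp_all add: odd_closed_form_def B_def algebra_simps)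
  next
    case 3
    then have d: "odd d" and nm: "n - m = d" using n by simp_all
    \<comment> \<open>In the statement the ln^2 2 part of \<open>B\<close> and the sum over 1/(4k^2)
      sit inside the coefficient of pi; this regrouping extracts them to match
      \<open>oddI\<close>.\<close>
    have alg: "x1 - x2 - (- F) + x3 + (- (10 / 9) - s3 + 1 / 4 * L + (- H)) * P - s4 * 16 * l + s5 * E
          + c + g - q
        = x1 - x2 + x3 + (- (10 / 9) - s3) * P - s4 * 16 * l + s5 * E + (P / 4 * L + c + g - q) - P * H + F"
      for x1 x2 F x3 s3 L H P s4 l s5 E c g q :: real
      by (simp add: algebra_simps)
    show ?case
      unfolding nm F_odd[OF d] H_odd[OF d] alg
      by (rule oddI[OF d]) (simp only: odd_closed_form_def B_def)
  next
    case 4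
    then have d: "even d" and nm: "n - m = d" using n by simp_all
    have alg: "x1 - x2 - F - x3 + (1 + s3 - 1 / 4 * L + H) * P + s4 * 2 * l + s5 * (E / 6) - c - g + q
        = x1 - x2 - x3 + (1 + s3) * P + s4 * 2 * l + s5 * (E / 6) - (P / 4 * L + c + g - q) + P * H - F"
      for x1 x2 F x3 s3 L H P s4 l s5 E c g q :: real
      by (simp add: algebra_simps)
    show ?case
      unfolding nm F_even[OF d] H_even[OF d] alg
      by (rule evenI[OF d]) (simp only: even_closed_form_def B_def)
  qed
qed

end
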